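(* Let $(M^n,g)$ be an oriented Riemannian spin manifold, $n\ge4$, with a 3-form $T\in\Lambda^3(M)$ satisfying $\nabla^cT=0$. Put $s=\frac{n-1}{4(n-3)}$ and $\lambda:=\frac{1}{2(n-3)}$. Let $\psi$ be a Killing spinor with torsion with Killing number $\kappa$, i.e. $\nabla^s_X\psi=\kappa X\cdot\psi$ for all $X$. Then the Ricci curvature of the characteristic connection satisfies for all vector fields $X$ the identity $$\mathrm{Ric}^c(X)\cdot\psi=-16s\kappa(X\lrcorner T)\cdot\psi+4(n-1)\kappa^2X\cdot\psi+(1-12\lambda^2)(X\lrcorner\sigma_T)\cdot\psi+2(2\lambda^2+\lambda)\sum_{k=1}^n e_k\cdot(T(X,e_k)\lrcorner T)\cdot\psi .$$
   Context: Conventions: Clifford multiplication on the complex spinor bundle satisfies $X\cdot X=-g(X,X)$; a differential form acts on spinors by $e_{i_1}\wedge\dots\wedge e_{i_k}\mapsto e_{i_1}\cdots e_{i_k}$ for orthonormal frames. $T(X,Y)$ denotes the vector with $g(T(X,Y),Z)=T(X,Y,Z)$. $e_1,\dots,e_n$ is a local orthonormal frame and $\sigma_T:=\frac12\sum_i(e_i\lrcorner T)\wedge(e_i\lrcorner T)$. $\nabla^g$ is the Levi-Civita connection; for $s\in\mathbb R$, $\nabla^s_XY=\nabla^g_XY+2s\,T(X,Y)$, lifted to spinors as $\nabla^s_X\psi=\nabla^g_X\psi+s(X\lrcorner T)\cdot\psi$. $\nabla^c:=\nabla^{1/4}$ is the connection with torsion $T$ ("characteristic connection"). $\mathrm{Ric}^c$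 is its Ricci tensor, $\mathrm{Ric}^c(X,Y)=\sum_m g(\mathcal R^c(e_m,X)Y,e_m)$, with $\mathcal R^c(X,Y)=\nabla^c_X\nabla^c_Y-\nabla^c_Y\nabla^c_X-\nabla^c_{[X,Y]}$, viewed as an endomorphism of the tangent bundle. $\kappa$ is a constant. *)

theory Defs
  imports "HOL-Analysis.Analysis"
begin

(* A spin manifold is given by a covering (U i) of M that trivialises everything at once: over U i
   there are a chart phi i, an oriented orthonormal frame e i and a trivialisation of the spin
   structure.  Every manifold with a spin structure has such a covering.  A field on M is the family
   of its local representatives, which are functions of the coordinates x in the open set
   phi i ` U i, related by the usual transformation law on overlaps. *)

section \<open>Local differential geometry in a coordinate domain\<close>

primrec Ck_on :: "nat \<Rightarrow> 'a::real_normed_vector set \<Rightarrow> ('a \<Rightarrow> 'b::real_normed_vector) \<Rightarrow> bool" where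
  "Ck_on 0 S f \<longleftrightarrow> continuous_on S f"
| "Ck_on (Suc k) S f \<longleftrightarrow> (\<forall>x\<in>S. f differentiable (at x)) \<and>
     (\<forall>v. Ck_on k S (\<lambda>x. frechet_derivative f (at x) v))"

(* Intended for open subsets S of a finite-dimensional space. *)
definition smooth_on :: "'a::real_normed_vector set \<Rightarrow> ('a \<Rightarrow> 'b::real_normed_vector) \<Rightarrow> bool" where
  "smooth_on S f \<longleftrightarrow> (\<forall>k. Ck_on k S f)"

abbreviation dderiv :: "('a::real_normed_vector \<Rightarrow> 'b::real_normed_vector) \<Rightarrow> 'a \<Rightarrow> 'a \<Rightarrow> 'b" where
  "dderiv f x v \<equiv> frechet_derivative f (at x) v"

type_synonym 'v form1 = "'v \<Rightarrow> real"
type_synonym 'v form2 = "'v \<Rightarrow> 'v \<Rightarrow> real"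
type_synonym 'v form3 = "'v \<Rightarrow> 'v \<Rightarrow> 'v \<Rightarrow> real"
type_synonym 'v form4 = "'v \<Rightarrow> 'v \<Rightarrow> 'v \<Rightarrow> 'v \<Rightarrow> real"

(* In this section G, T and E are the coordinate expressions of the metric, of a 3-form and of an
   orthonormal frame; their first argument (for E: the second one) is the point. *)

definition sharp :: "('v \<Rightarrow> 'v form2) \<Rightarrow> 'v \<Rightarrow> 'v form1 \<Rightarrow> 'v" where
  "sharp G x \<alpha> = (THE u. \<forall>z. G x u z = \<alpha> z)"

definition lie_bracket ::
    "('v \<Rightarrow> 'v) \<Rightarrow> ('v \<Rightarrow> 'v) \<Rightarrow> 'v \<Rightarrow> 'v::real_normed_vector" where
  "lie_bracket X Y x = dderiv Y x (X x) - dderiv X x (Y x)"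

definition christoffel ::
    "('v \<Rightarrow> 'v form2) \<Rightarrow> 'v \<Rightarrow> 'v \<Rightarrow> 'v \<Rightarrow> 'v::real_normed_vector" where
  "christoffel G x v w = sharp G x (\<lambda>z.
     (dderiv (\<lambda>y. G y w z) x v + dderiv (\<lambda>y. G y z v) x w - dderiv (\<lambda>y. G y v w) x z) / 2)"

(* nabla^g_v Y at the point x *)
definition levi_civita ::
    "('v \<Rightarrow> 'v form2) \<Rightarrow> 'v \<Rightarrow> 'v \<Rightarrow> ('v \<Rightarrow> 'v) \<Rightarrow> 'v::real_normed_vector" where
  "levi_civita G x v Y = dderiv Y x v + christoffel G x v (Y x)"

(* T(v,w) as a vector *)
definition torsion_vec :: "('v \<Rightarrow> 'v form2) \<Rightarrow> ('v \<Rightarrow> 'v form3) \<Rightarrow> 'v \<Rightarrow> 'v \<Rightarrow> 'v \<Rightarrow> 'v" where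
  "torsion_vec G T x v w = sharp G x (T x v w)"

(* nabla^s_v Y at the point x *)
definition nabla ::
    "('v \<Rightarrow> 'v form2) \<Rightarrow> ('v \<Rightarrow> 'v form3) \<Rightarrow> real \<Rightarrow> 'v \<Rightarrow> 'v \<Rightarrow> ('v \<Rightarrow> 'v) \<Rightarrow> 'v::real_normed_vector"
  where
  "nabla G T s x v Y = levi_civita G x v Y + (2 * s) *\<^sub>R torsion_vec G T x v (Y x)"

definition char_nabla ::
    "('v \<Rightarrow> 'v form2) \<Rightarrow> ('v \<Rightarrow> 'v form3) \<Rightarrow> 'v \<Rightarrow> 'v \<Rightarrow> ('v \<Rightarrow> 'v) \<Rightarrow> 'v::real_normed_vector"
  where
  "char_nabla G T = nabla G T (1/4)"

definition char_curv ::
    "('v \<Rightarrow> 'v form2) \<Rightarrow> ('v \<Rightarrow> 'v form3) \<Rightarrow> ('v \<Rightarrow> 'v) \<Rightarrow> ('v \<Rightarrow> 'v) \<Rightarrow> ('v \<Rightarrow> 'v) \<Rightarrow>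
      'v \<Rightarrow> 'v::real_normed_vector" where
  "char_curv G T X Y Z x =
     char_nabla G T x (X x) (\<lambda>y. char_nabla G T y (Y y) Z)
     - char_nabla G T x (Y x) (\<lambda>y. char_nabla G T y (X y) Z)
     - char_nabla G T x (lie_bracket X Y x) Z"

definition char_Ric ::
    "('v \<Rightarrow> 'v form2) \<Rightarrow> ('v \<Rightarrow> 'v form3) \<Rightarrow> ('n \<Rightarrow> 'v \<Rightarrow> 'v) \<Rightarrow> ('v \<Rightarrow> 'v) \<Rightarrow> ('v \<Rightarrow> 'v) \<Rightarrow>
      'v::real_normed_vector \<Rightarrow> real" where
  "char_Ric G T E X Y x = (\<Sum>m\<in>UNIV. G x (char_curv G T (E m) X Y x) (E m x))"

definition char_Ric_endo ::
    "('v \<Rightarrow> 'v form2) \<Rightarrow> ('v \<Rightarrow> 'v form3) \<Rightarrow> ('n \<Rightarrow> 'v \<Rightarrow> 'v) \<Rightarrow> ('v \<Rightarrow> 'v) \<Rightarrow>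
      'v \<Rightarrow> 'v::real_normed_vector" where
  "char_Ric_endo G T E X x = (\<Sum>b\<in>UNIV. char_Ric G T E X (E b) x *\<^sub>R E b x)"

(* (nabla^c_v T)(Y,Z,W) at the point x *)
definition char_nabla_T ::
    "('v \<Rightarrow> 'v form2) \<Rightarrow> ('v \<Rightarrow> 'v form3) \<Rightarrow> 'v \<Rightarrow> 'v \<Rightarrow>
      ('v \<Rightarrow> 'v) \<Rightarrow> ('v \<Rightarrow> 'v) \<Rightarrow> ('v \<Rightarrow> 'v::real_normed_vector) \<Rightarrow> real" where
  "char_nabla_T G T x v Y Z W =
     dderiv (\<lambda>y. T y (Y y) (Z y) (W y)) x v
     - T x (char_nabla G T x v Y) (Z x) (W x)
     - T x (Y x) (char_nabla G T x v Z) (W x)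
     - T x (Y x) (Z x) (char_nabla G T x v W)"

(* Wedge product of 2-forms as a sum over shuffles, so that (e1 /\ e2)(e1,e2) = 1 for a dual basis. *)
definition wedge22 :: "'v form2 \<Rightarrow> 'v form2 \<Rightarrow> 'v form4" where
  "wedge22 \<alpha> \<beta> u v w z =
     \<alpha> u v * \<beta> w z - \<alpha> u w * \<beta> v z + \<alpha> u z * \<beta> v w
     + \<alpha> v w * \<beta> u z - \<alpha> v z * \<beta> u w + \<alpha> w z * \<beta> u v"

definition sigma_form :: "('n \<Rightarrow> 'v \<Rightarrow> 'v) \<Rightarrow> ('v \<Rightarrow> 'v form3) \<Rightarrow> 'v \<Rightarrow> 'v form4" where
  "sigma_form E T x u v w z =
     (1/2) * (\<Sum>a\<in>UNIV. wedge22 (T x (E a x)) (T x (E a x)) u v w z)"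

section \<open>Clifford multiplication\<close>

definition cliff_vec ::
    "('n \<Rightarrow> complex^'s^'s) \<Rightarrow> ('v \<Rightarrow> 'v form2) \<Rightarrow> ('n \<Rightarrow> 'v \<Rightarrow> 'v) \<Rightarrow> 'v \<Rightarrow> 'v \<Rightarrow> complex^'s^'s" where
  "cliff_vec \<gamma> G E x v = (\<Sum>a\<in>UNIV. G x v (E a x) *\<^sub>R \<gamma> a)"

(* The index type need not be ordered: for an alternating k-form the sum over increasing index
   tuples equals 1/k! times the sum over all index tuples. *)
definition cliff_form2 ::
    "('n \<Rightarrow> complex^'s^'s) \<Rightarrow> ('n \<Rightarrow> 'v \<Rightarrow> 'v) \<Rightarrow> 'v \<Rightarrow> 'v form2 \<Rightarrow> complex^'s^'s" where
  "cliff_form2 \<gamma> E x \<omega> =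
     (1 / fact 2) *\<^sub>R (\<Sum>a\<in>UNIV. \<Sum>b\<in>UNIV. \<omega> (E a x) (E b x) *\<^sub>R (\<gamma> a ** \<gamma> b))"

definition cliff_form3 ::
    "('n \<Rightarrow> complex^'s^'s) \<Rightarrow> ('n \<Rightarrow> 'v \<Rightarrow> 'v) \<Rightarrow> 'v \<Rightarrow> 'v form3 \<Rightarrow> complex^'s^'s" where
  "cliff_form3 \<gamma> E x \<omega> =
     (1 / fact 3) *\<^sub>R (\<Sum>a\<in>UNIV. \<Sum>b\<in>UNIV. \<Sum>c\<in>UNIV.
        \<omega> (E a x) (E b x) (E c x) *\<^sub>R (\<gamma> a ** \<gamma> b ** \<gamma> c))"

(* nabla^g_v psi in the trivialisation belonging to the frame E: the lift of the connection form
   g(nabla^g e_a, e_b), that is, d psi(v) + 1/2 sum_{a<b} g(nabla^g_v e_a, e_b) e_a e_b psi. *)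
definition spin_levi_civita ::
    "('n \<Rightarrow> complex^'s^'s) \<Rightarrow> ('v \<Rightarrow> 'v form2) \<Rightarrow> ('n \<Rightarrow> 'v \<Rightarrow> 'v) \<Rightarrow>
      'v::real_normed_vector \<Rightarrow> 'v \<Rightarrow> ('v \<Rightarrow> complex^'s) \<Rightarrow> complex^'s" where
  "spin_levi_civita \<gamma> G E x v \<psi> =
     dderiv \<psi> x v
     + (1/4) *\<^sub>R ((\<Sum>a\<in>UNIV. \<Sum>b\<in>UNIV.
          G x (levi_civita G x v (E a)) (E b x) *\<^sub>R (\<gamma> a ** \<gamma> b)) *v \<psi> x)"

definition spin_nabla ::
    "('n \<Rightarrow> complex^'s^'s) \<Rightarrow> ('v \<Rightarrow> 'v form2) \<Rightarrow> ('n \<Rightarrow> 'v \<Rightarrow> 'v) \<Rightarrow> ('v \<Rightarrow> 'v form3) \<Rightarrow> real \<Rightarrow>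
      'v::real_normed_vector \<Rightarrow> 'v \<Rightarrow> ('v \<Rightarrow> complex^'s) \<Rightarrow> complex^'s" where
  "spin_nabla \<gamma> G E T s x v \<psi> =
     spin_levi_civita \<gamma> G E x v \<psi> + s *\<^sub>R (cliff_form2 \<gamma> E x (T x v) *v \<psi> x)"

(* The image of Spin(n), the group of products of an even number of unit vectors, under the spin
   representation given by the Clifford matrices gamma; that representation is faithful. *)
inductive_set spin_group :: "('n::finite \<Rightarrow> complex^'s^'s) \<Rightarrow> (complex^'s^'s) set"
  for \<gamma> :: "'n \<Rightarrow> complex^'s^'s" where
  one: "mat 1 \<in> spin_group \<gamma>"
| mult: "\<lbrakk>A \<in> spin_group \<gamma>; norm (u::real^'n) = 1; norm (v::real^'n) = 1\<rbrakk> \<Longrightarrow>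
     (\<Sum>a\<in>UNIV. u $ a *\<^sub>R \<gamma> a) ** (\<Sum>b\<in>UNIV. v $ b *\<^sub>R \<gamma> b) ** A \<in> spin_group \<gamma>"

section \<open>Manifolds and fields\<close>

definition transition ::
    "('i \<Rightarrow> 'm set) \<Rightarrow> ('i \<Rightarrow> 'm \<Rightarrow> real^'n) \<Rightarrow> 'i \<Rightarrow> 'i \<Rightarrow> real^'n \<Rightarrow> real^'n" where
  "transition U \<phi> i j = \<phi> j \<circ> inv_into (U i) (\<phi> i)"

(* Tangent map from chart i to chart j at the point p of M *)
definition tangent_change ::
    "('i \<Rightarrow> 'm set) \<Rightarrow> ('i \<Rightarrow> 'm \<Rightarrow> real^'n) \<Rightarrow> 'i \<Rightarrow> 'i \<Rightarrow> 'm \<Rightarrow> real^'n \<Rightarrow> real^'n" where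
  "tangent_change U \<phi> i j p v = dderiv (transition U \<phi> i j) (\<phi> i p) v"

locale oriented_manifold =
  fixes U :: "'i \<Rightarrow> 'm::{t2_space, second_countable_topology} set"
    and \<phi> :: "'i \<Rightarrow> 'm \<Rightarrow> real^'n"
  assumes open_dom: "open (U i)"
    and cover: "(\<Union>i. U i) = UNIV"
    and open_img: "open (\<phi> i ` U i)"
    and chart: "homeomorphism (U i) (\<phi> i ` U i) (\<phi> i) (inv_into (U i) (\<phi> i))"
    and transition_smooth: "smooth_on (\<phi> i ` (U i \<inter> U j)) (transition U \<phi> i j)"
    and transition_oriented: "p \<in> U i \<inter> U j \<Longrightarrow> det (matrix (tangent_change U \<phi> i j p)) > 0"

locale oriented_riemannian_manifold = oriented_manifold U \<phi>
  for U :: "'i \<Rightarrow> 'm::{t2_space, second_countable_topology} set"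
    and \<phi> :: "'i \<Rightarrow> 'm \<Rightarrow> real^'n" +
  fixes g :: "'i \<Rightarrow> real^'n \<Rightarrow> (real^'n) form2"
  assumes metric_bilinear: "x \<in> \<phi> i ` U i \<Longrightarrow> bilinear (g i x)"
    and metric_sym: "x \<in> \<phi> i ` U i \<Longrightarrow> g i x v w = g i x w v"
    and metric_pos: "x \<in> \<phi> i ` U i \<Longrightarrow> v \<noteq> 0 \<Longrightarrow> g i x v v > 0"
    and metric_smooth: "smooth_on (\<phi> i ` U i) (\<lambda>x. g i x v w)"
    and metric_change: "p \<in> U i \<inter> U j \<Longrightarrow>
      g j (\<phi> j p) (tangent_change U \<phi> i j p v) (tangent_change U \<phi> i j p w) = g i (\<phi> i p) v w"

(* The spin structure is the cocycle h, which lifts the SO(n)-valued transition functions of the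
   oriented orthonormal frame bundle: if the frames are related by e j = e i A with A in SO(n), then
   h i j satisfies h i j * gamma(v) = gamma(A v) * h i j, i.e. it covers A under Spin(n) -> SO(n).
   The dimension of the Clifford module makes it the complex spin representation. *)
locale spin_manifold = oriented_riemannian_manifold U \<phi> g
  for U :: "'i \<Rightarrow> 'm::{t2_space, second_countable_topology} set"
    and \<phi> :: "'i \<Rightarrow> 'm \<Rightarrow> real^'n"
    and g :: "'i \<Rightarrow> real^'n \<Rightarrow> (real^'n) form2" +
  fixes e :: "'i \<Rightarrow> 'n \<Rightarrow> real^'n \<Rightarrow> real^'n"
    and \<gamma> :: "'n \<Rightarrow> complex^'s^'s"
    and h :: "'i \<Rightarrow> 'i \<Rightarrow> 'm \<Rightarrow> complex^'s^'s"
  assumes frame_smooth: "smooth_on (\<phi> i ` U i) (e i a)"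
    and frame_orthonormal: "x \<in> \<phi> i ` U i \<Longrightarrow> g i x (e i a x) (e i b x) = (if a = b then 1 else 0)"
    and frame_oriented: "x \<in> \<phi> i ` U i \<Longrightarrow> det (\<chi> a. e i a x) > 0"
    and clifford: "\<gamma> a ** \<gamma> b + \<gamma> b ** \<gamma> a = mat (if a = b then - 2 else 0)"
    and spinor_dim: "CARD('s) = 2 ^ (CARD('n) div 2)"
    and lift_spin: "p \<in> U i \<inter> U j \<Longrightarrow> h i j p \<in> spin_group \<gamma>"
    and lift_smooth: "smooth_on (\<phi> i ` (U i \<inter> U j)) (h i j \<circ> inv_into (U i) (\<phi> i))"
    and lift_covers: "p \<in> U i \<inter> U j \<Longrightarrow>
      h i j p ** \<gamma> a =
        cliff_vec \<gamma> (g i) (e i) (\<phi> i p) (tangent_change U \<phi> j i p (e j a (\<phi> j p))) ** h i j p"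
    and cocycle: "p \<in> U i \<inter> U j \<inter> U k \<Longrightarrow> h i j p ** h j k p = h i k p"

definition vector_field ::
    "('i \<Rightarrow> 'm set) \<Rightarrow> ('i \<Rightarrow> 'm \<Rightarrow> real^'n) \<Rightarrow> ('i \<Rightarrow> real^'n \<Rightarrow> real^'n) \<Rightarrow> bool" where
  "vector_field U \<phi> X \<longleftrightarrow>
     (\<forall>i. smooth_on (\<phi> i ` U i) (X i)) \<and>
     (\<forall>i j. \<forall>p \<in> U i \<inter> U j. X j (\<phi> j p) = tangent_change U \<phi> i j p (X i (\<phi> i p)))"

definition three_form ::
    "('i \<Rightarrow> 'm set) \<Rightarrow> ('i \<Rightarrow> 'm \<Rightarrow> real^'n) \<Rightarrow> ('i \<Rightarrow> real^'n \<Rightarrow> (real^'n) form3) \<Rightarrow> bool" where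
  "three_form U \<phi> T \<longleftrightarrow>
     (\<forall>i. \<forall>x \<in> \<phi> i ` U i. \<forall>u v w. linear (\<lambda>y. T i x y v w) \<and>
        T i x u v w = - T i x v u w \<and> T i x u v w = - T i x u w v) \<and>
     (\<forall>i u v w. smooth_on (\<phi> i ` U i) (\<lambda>x. T i x u v w)) \<and>
     (\<forall>i j. \<forall>p \<in> U i \<inter> U j. \<forall>u v w.
        T j (\<phi> j p) (tangent_change U \<phi> i j p u) (tangent_change U \<phi> i j p v)
          (tangent_change U \<phi> i j p w) = T i (\<phi> i p) u v w)"

definition spinor_field ::
    "('i \<Rightarrow> 'm set) \<Rightarrow> ('i \<Rightarrow> 'm \<Rightarrow> real^'n) \<Rightarrow> ('i \<Rightarrow> 'i \<Rightarrow> 'm \<Rightarrow> complex^'s^'s) \<Rightarrow>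
      ('i \<Rightarrow> real^'n \<Rightarrow> complex^'s) \<Rightarrow> bool" where
  "spinor_field U \<phi> h \<psi> \<longleftrightarrow>
     (\<forall>i. smooth_on (\<phi> i ` U i) (\<psi> i)) \<and>
     (\<forall>i j. \<forall>p \<in> U i \<inter> U j. \<psi> i (\<phi> i p) = h i j p *v \<psi> j (\<phi> j p))"

(* nabla^c T = 0 *)
definition char_parallel ::
    "('i \<Rightarrow> 'm set) \<Rightarrow> ('i \<Rightarrow> 'm \<Rightarrow> real^'n) \<Rightarrow> ('i \<Rightarrow> real^'n \<Rightarrow> (real^'n) form2) \<Rightarrow>
      ('i \<Rightarrow> real^'n \<Rightarrow> (real^'n) form3) \<Rightarrow> bool" where
  "char_parallel U \<phi> g T \<longleftrightarrow>
     (\<forall>i Y Z W. smooth_on (\<phi> i ` U i) Y \<longrightarrow> smooth_on (\<phi> i ` U i) Z \<longrightarrow> smooth_on (\<phi> i ` U i) W \<longrightarrow>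
        (\<forall>x \<in> \<phi> i ` U i. \<forall>v. char_nabla_T (g i) (T i) x v Y Z W = 0))"

(* The Killing equation is tensorial in the direction, which runs over all tangent vectors v. *)
definition killing_spinor_torsion ::
    "('i \<Rightarrow> 'm set) \<Rightarrow> ('i \<Rightarrow> 'm \<Rightarrow> real^'n) \<Rightarrow> ('i \<Rightarrow> real^'n \<Rightarrow> (real^'n) form2) \<Rightarrow>
      ('i \<Rightarrow> 'n \<Rightarrow> real^'n \<Rightarrow> real^'n) \<Rightarrow> ('n \<Rightarrow> complex^'s^'s) \<Rightarrow> ('i \<Rightarrow> 'i \<Rightarrow> 'm \<Rightarrow> complex^'s^'s) \<Rightarrow>
      ('i \<Rightarrow> real^'n \<Rightarrow> (real^'n) form3) \<Rightarrow> real \<Rightarrow> complex \<Rightarrow> ('i \<Rightarrow> real^'n \<Rightarrow> complex^'s) \<Rightarrow> bool"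
  where
  "killing_spinor_torsion U \<phi> g e \<gamma> h T s \<kappa> \<psi> \<longleftrightarrow>
     spinor_field U \<phi> h \<psi> \<and>
     (\<forall>i. \<forall>x \<in> \<phi> i ` U i. \<forall>v.
        spin_nabla \<gamma> (g i) (e i) (T i) s x v (\<psi> i)
          = \<kappa> *s (cliff_vec \<gamma> (g i) (e i) x v *v \<psi> i x))"

end

(* The Killing equation says nabla^c_v psi = A(v) psi with A(v) = kappa v - lam (v _| T), an
   endomorphism that is parallel because nabla^c T = 0.  Hence the curvature acts on psi by
   R(u,v) psi = ([A(v), A(u)] + A(T(u,v))) psi.  On the other hand, the Clifford contraction
   sum_k e_k R(X,e_k) equals (X _| sigma_T - Ric(X)) / 2 by the first Bianchi identity for a parallel
   torsion.  Comparing the two leaves a computation in the Clifford algebra, in which the value of s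
   enters only through s = lam + 1/4. *)
theory Submission
  imports Defs
begin

section \<open>Derivatives\<close>

text \<open>Everything is unfolded into ordinary derivatives in one chart, with vectors u, v that
  are constant in the coordinates, so that no brackets occur. Two first-order equations then carry
  the geometry: the first structure equation of the coframe \<open>theta\<close>, and the Killing
  equation solved for the derivative of \<psi>. Differentiating each once more and exchanging the
  order of differentiation yields the Bianchi identity and the curvature formula on \<psi>,
  respectively.

  On the Clifford side the obstacle is that the coefficient arrays q k a b to be contracted are skew
  in a, b only, so they are not 3-forms. Their cyclic sum is totally skew, and the difference from
  the array itself costs a trace vector. This one identity evaluates three sums: the curvature
  contraction, the commutators of X _| T with e_k _| T, and the sum of e_k (T(X,e_k) _| T). The last
  two have the same trace vector; eliminating it leaves only X _| sigma_T and that last sum as terms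
  quadratic in T.\<close>

lemma second_difference_bound:
  fixes f :: "'a::real_normed_vector \<Rightarrow> real"
  assumes S: "open S" "x \<in> S" and f: "\<And>y. y \<in> S \<Longrightarrow> (f has_derivative f' y) (at y)"
    and Dv: "((\<lambda>y. f' y v) has_derivative Dv) (at x)" and "e > 0"
  shows "\<forall>\<^sub>F t in at_right 0. \<bar>f (x + t *\<^sub>R v + t *\<^sub>R w) - f (x + t *\<^sub>R v) - f (x + t *\<^sub>R w) + f x
    - t\<^sup>2 * Dv w\<bar> \<le> e * t\<^sup>2"
proof -
  define C where "C = norm v + norm w + 1"
  have C: "C > 0" "norm v \<le> C" "norm v + norm w \<le> C" by (simp_all add: C_def add_nonneg_pos)
  interpret Dv: bounded_linear Dv using Dv by (rule has_derivative_bounded_linear)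
  \<comment> \<open>Two errors of size \<open>d * (t * C)\<close> occur below and may together
    amount to \<open>e * t\<close>.\<close>
  define d where "d = e / (2 * C)"
  have "d > 0" using C \<open>e > 0\<close> by (simp add: d_def)
  then obtain \<delta>1 where \<delta>1: "\<delta>1 > 0"
    "\<And>y. norm (y - x) < \<delta>1 \<Longrightarrow> \<bar>f' y v - f' x v - Dv (y - x)\<bar> \<le> d * norm (y - x)"
    using Dv unfolding has_derivative_at_alt real_norm_def by blast
  obtain \<delta>2 where \<delta>2: "\<delta>2 > 0" "ball x \<delta>2 \<subseteq> S"
    using S by (meson openE)
  define \<delta> where "\<delta> = min \<delta>1 \<delta>2"
  have \<delta>: "\<delta> > 0" using \<delta>1 \<delta>2 by (simp add: \<delta>_def)
  have main: "\<bar>f (x + t *\<^sub>R v + t *\<^sub>R w) - f (x + t *\<^sub>R v) - f (x + t *\<^sub>R w) + f x - t\<^sup>2 * Dv w\<bar> \<le> e * t\<^sup>2"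
    if t: "0 < t" "t < \<delta> / C" for t
  proof -
    have tC: "t * C < \<delta>" using t C by (simp add: field_simps)
    have near: "norm (r *\<^sub>R v + q *\<^sub>R w) \<le> t * C" if "0 \<le> r" "r \<le> t" "0 \<le> q" "q \<le> t" for r q
    proof -
      have "norm (r *\<^sub>R v + q *\<^sub>R w) \<le> r * norm v + q * norm w"
        using norm_triangle_ineq[of "r *\<^sub>R v" "q *\<^sub>R w"] that by simp
      also have "\<dots> \<le> t * norm v + t * norm w"
        using that by (intro add_mono mult_right_mono) auto
      also have "\<dots> = t * (norm v + norm w)" by (simp add: distrib_left)
      also have "\<dots> \<le> t * C" using C t by (intro mult_left_mono) auto
      finally show ?thesis .
    qed
    have inS: "x + r *\<^sub>R v + q *\<^sub>R w \<in> S" if "0 \<le> r" "r \<le> t" "0 \<le> q" "q \<le> t" for r q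
    proof -
      have "dist x (x + r *\<^sub>R v + q *\<^sub>R w) = norm (r *\<^sub>R v + q *\<^sub>R w)"
        by (simp add: dist_norm norm_minus_commute add.assoc add.commute)
      also have "\<dots> < \<delta>2" using near[OF that] tC by (simp add: \<delta>_def)
      finally show ?thesis using \<delta>2 by auto
    qed
    have deriv: "((\<lambda>r. f (x + r *\<^sub>R v + q *\<^sub>R w)) has_real_derivative f' (x + r *\<^sub>R v + q *\<^sub>R w) v) (at r)"
      if "0 \<le> r" "r \<le> t" "0 \<le> q" "q \<le> t" for r q
    proof -
      have "((\<lambda>r. x + r *\<^sub>R v + q *\<^sub>R w) has_derivative (\<lambda>h. h *\<^sub>R v)) (at r)"
        by (auto intro!: derivative_eq_intros)
      from diff_chain_at[OF this f[OF inS[OF that]]]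
      have "((\<lambda>r. f (x + r *\<^sub>R v + q *\<^sub>R w)) has_derivative (\<lambda>h. f' (x + r *\<^sub>R v + q *\<^sub>R w) (h *\<^sub>R v))) (at r)"
        by (simp add: o_def)
      also have "(\<lambda>h. f' (x + r *\<^sub>R v + q *\<^sub>R w) (h *\<^sub>R v)) = (*) (f' (x + r *\<^sub>R v + q *\<^sub>R w) v)"
        using linear_cmul[OF has_derivative_linear[OF f[OF inS[OF that]]]]
        by (simp add: fun_eq_iff mult.commute)
      finally show ?thesis unfolding has_field_derivative_def .
    qed
    \<comment> \<open>Mean value theorem in direction v, for the difference of f along two parallel
      segments. Afterwards the differentiability of \<open>f' y v\<close> at the single point x is
      enough.\<close>
    have "\<exists>z>0. z < t \<and> (f (x + t *\<^sub>R v + t *\<^sub>R w) - f (x + t *\<^sub>R v + 0 *\<^sub>R w))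
        - (f (x + 0 *\<^sub>R v + t *\<^sub>R w) - f (x + 0 *\<^sub>R v + 0 *\<^sub>R w))
        = (t - 0) * (f' (x + z *\<^sub>R v + t *\<^sub>R w) v - f' (x + z *\<^sub>R v + 0 *\<^sub>R w) v)"
    proof (rule MVT2[OF t(1)])
      fix r assume "0 \<le> r" "r \<le> t"
      then show "((\<lambda>r. f (x + r *\<^sub>R v + t *\<^sub>R w) - f (x + r *\<^sub>R v + 0 *\<^sub>R w)) has_real_derivative
          f' (x + r *\<^sub>R v + t *\<^sub>R w) v - f' (x + r *\<^sub>R v + 0 *\<^sub>R w) v) (at r)"
        using t by (intro DERIV_diff deriv) simp_all
    qed
    then obtain z where z: "0 < z" "z < t"
      "f (x + t *\<^sub>R v + t *\<^sub>R w) - f (x + t *\<^sub>R v) - f (x + t *\<^sub>R w) + f x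
        = t * (f' (x + z *\<^sub>R v + t *\<^sub>R w) v - f' (x + z *\<^sub>R v) v)"
      by auto
    have err: "\<bar>f' (x + z *\<^sub>R v + q *\<^sub>R w) v - f' x v - Dv (z *\<^sub>R v + q *\<^sub>R w)\<bar> \<le> d * (t * C)"
      if "0 \<le> q" "q \<le> t" for q
    proof -
      have n: "norm (z *\<^sub>R v + q *\<^sub>R w) \<le> t * C" using near[of z q] z that by simp
      then have "\<bar>f' (x + z *\<^sub>R v + q *\<^sub>R w) v - f' x v - Dv (z *\<^sub>R v + q *\<^sub>R w)\<bar>
          \<le> d * norm (z *\<^sub>R v + q *\<^sub>R w)"
        using \<delta>1(2)[of "x + z *\<^sub>R v + q *\<^sub>R w"] tC by (simp add: \<delta>_def add.assoc)
      also have "\<dots> \<le> d * (t * C)" using n \<open>d > 0\<close> by simp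
      finally show ?thesis .
    qed
    \<comment> \<open>The unknown intermediate point z drops out of the linear part.\<close>
    have "Dv (z *\<^sub>R v + t *\<^sub>R w) - Dv (z *\<^sub>R v) = t * Dv w"
      by (simp add: Dv.add Dv.scaleR)
    then have "\<bar>(f' (x + z *\<^sub>R v + t *\<^sub>R w) v - f' (x + z *\<^sub>R v) v) - t * Dv w\<bar> \<le> 2 * (d * (t * C))"
      using err[of t] err[of 0] t by simp
    also have "\<dots> = e * t" using C by (simp add: d_def)
    finally have *: "\<bar>(f' (x + z *\<^sub>R v + t *\<^sub>R w) v - f' (x + z *\<^sub>R v) v) - t * Dv w\<bar> \<le> e * t" .
    have "\<bar>t * (f' (x + z *\<^sub>R v + t *\<^sub>R w) v - f' (x + z *\<^sub>R v) v) - t\<^sup>2 * Dv w\<bar>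
      = \<bar>t * ((f' (x + z *\<^sub>R v + t *\<^sub>R w) v - f' (x + z *\<^sub>R v) v) - t * Dv w)\<bar>"
      by (simp only: power2_eq_square right_diff_distrib mult.assoc)
    also have "\<dots> = t * \<bar>(f' (x + z *\<^sub>R v + t *\<^sub>R w) v - f' (x + z *\<^sub>R v) v) - t * Dv w\<bar>"
      by (simp only: abs_mult abs_of_pos[OF t(1)])
    also have "\<dots> \<le> t * (e * t)" using * t by (intro mult_left_mono) auto
    also have "t * (e * t) = e * t\<^sup>2" by (simp add: power2_eq_square)
    finally show ?thesis unfolding z .
  qed
  show ?thesis
    unfolding eventually_at_right_field
    by (intro exI[of _ "\<delta> / C"] conjI allI impI main) (use \<delta> C in auto)
qed

text \<open>The second difference of f is symmetric in v and w, so both sides are the limit of the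
  same quotient.\<close>

lemma second_derivative_symmetric_real:
  fixes f :: "'a::real_normed_vector \<Rightarrow> real"
  assumes S: "open S" "x \<in> S" and f: "\<And>y. y \<in> S \<Longrightarrow> (f has_derivative f' y) (at y)"
    and Dv: "((\<lambda>y. f' y v) has_derivative Dv) (at x)"
    and Dw: "((\<lambda>y. f' y w) has_derivative Dw) (at x)"
  shows "Dv w = Dw v"
proof (rule ccontr)
  assume ne: "Dv w \<noteq> Dw v"
  \<comment> \<open>With a quarter of the gap, the two error bounds add up to only half of
    it.\<close>
  define e where "e = \<bar>Dv w - Dw v\<bar> / 4"
  have e: "e > 0" using ne by (simp add: e_def)
  note bound = second_difference_bound[where f=f and f'=f', OF S f]
  have "\<forall>\<^sub>F t in at_right 0. \<bar>f (x + t *\<^sub>R v + t *\<^sub>R w) - f (x + t *\<^sub>R v) - f (x + t *\<^sub>R w) + f x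
      - t\<^sup>2 * Dv w\<bar> \<le> e * t\<^sup>2"
    by (rule bound[OF _ Dv e])
  moreover have "\<forall>\<^sub>F t in at_right 0. \<bar>f (x + t *\<^sub>R w + t *\<^sub>R v) - f (x + t *\<^sub>R w) - f (x + t *\<^sub>R v) + f x
      - t\<^sup>2 * Dw v\<bar> \<le> e * t\<^sup>2"
    by (rule bound[OF _ Dw e])
  moreover have "\<forall>\<^sub>F t in at_right (0::real). 0 < t"
    by (rule eventually_at_right_less)
  ultimately have "\<forall>\<^sub>F t in at_right (0::real). False"
  proof eventually_elim
    case (elim t)
    have "x + t *\<^sub>R w + t *\<^sub>R v = x + t *\<^sub>R v + t *\<^sub>R w" by (simp add: add_ac)
    with elim have "\<bar>t\<^sup>2 * Dv w - t\<^sup>2 * Dw v\<bar> \<le> 2 * e * t\<^sup>2" by simp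
    moreover have "\<bar>t\<^sup>2 * Dv w - t\<^sup>2 * Dw v\<bar> = t\<^sup>2 * \<bar>Dv w - Dw v\<bar>"
      unfolding right_diff_distrib[symmetric] abs_mult by simp
    ultimately have "t\<^sup>2 * \<bar>Dv w - Dw v\<bar> \<le> t\<^sup>2 * (2 * e)"
      by (simp add: mult.commute)
    with elim have "\<bar>Dv w - Dw v\<bar> \<le> 2 * e" by simp
    with ne show False by (simp add: e_def)
  qed
  then show False by simp
qed

lemma second_derivative_symmetric:
  fixes f :: "'a::real_normed_vector \<Rightarrow> 'b::euclidean_space"
  assumes S: "open S" "x \<in> S" and f: "\<And>y. y \<in> S \<Longrightarrow> (f has_derivative f' y) (at y)"
    and Dv: "((\<lambda>y. f' y v) has_derivative Dv) (at x)"
    and Dw: "((\<lambda>y. f' y w) has_derivative Dw) (at x)"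
  shows "Dv w = Dw v"
proof (rule euclidean_eqI)
  fix b :: 'b
  show "Dv w \<bullet> b = Dw v \<bullet> b"
    by (rule second_derivative_symmetric_real[OF S, of "\<lambda>y. f y \<bullet> b" "\<lambda>y h. f' y h \<bullet> b"])
      (intro has_derivative_inner_left f Dv Dw; assumption)+
qed

text \<open>A product rule for forms whose derivatives are known for constant arguments only, as is
  the case for the metric and for T: the moving argument is expanded in the standard basis.
  Uniqueness of derivatives forces \<open>F'\<close> to be linear in its first argument.\<close>

lemma has_derivative_linear_slot:
  fixes F :: "'a::real_normed_vector \<Rightarrow> 'b::euclidean_space \<Rightarrow> 'c::real_normed_vector"
  assumes S: "open S" "x \<in> S" and lin: "\<And>y. y \<in> S \<Longrightarrow> linear (F y)"
    and F: "\<And>b. ((\<lambda>y. F y b) has_derivative F' b) (at x)"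
    and Y: "(Y has_derivative Y') (at x)"
  shows "((\<lambda>y. F y (Y y)) has_derivative (\<lambda>h. F' (Y x) h + F x (Y' h))) (at x)"
proof -
  have exp: "F y b = (\<Sum>i\<in>Basis. (b \<bullet> i) *\<^sub>R F y i)" if "y \<in> S" for y b
    using linear_sum[OF lin[OF that], of "\<lambda>i. (b \<bullet> i) *\<^sub>R i" Basis]
    by (simp add: euclidean_representation linear_cmul[OF lin[OF that]])
  have "((\<lambda>y. \<Sum>i\<in>Basis. (b \<bullet> i) *\<^sub>R F y i) has_derivative (\<lambda>h. \<Sum>i\<in>Basis. (b \<bullet> i) *\<^sub>R F' i h)) (at x)" for b
    by (intro has_derivative_sum has_derivative_scaleR_right F)
  then have "((\<lambda>y. F y b) has_derivative (\<lambda>h. \<Sum>i\<in>Basis. (b \<bullet> i) *\<^sub>R F' i h)) (at x)" for b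
    by (rule has_derivative_transform_within_open[OF _ S]) (simp add: exp[symmetric])
  then have F'_eq: "F' b = (\<lambda>h. \<Sum>i\<in>Basis. (b \<bullet> i) *\<^sub>R F' i h)" for b
    by (rule has_derivative_unique[OF F])
  have "((\<lambda>y. \<Sum>i\<in>Basis. (Y y \<bullet> i) *\<^sub>R F y i) has_derivative
      (\<lambda>h. \<Sum>i\<in>Basis. (Y x \<bullet> i) *\<^sub>R F' i h + (Y' h \<bullet> i) *\<^sub>R F x i)) (at x)"
    by (intro has_derivative_sum has_derivative_scaleR has_derivative_inner_left F Y)
  then have "((\<lambda>y. F y (Y y)) has_derivative
      (\<lambda>h. \<Sum>i\<in>Basis. (Y x \<bullet> i) *\<^sub>R F' i h + (Y' h \<bullet> i) *\<^sub>R F x i)) (at x)"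
    by (rule has_derivative_transform_within_open[OF _ S]) (simp add: exp[symmetric])
  moreover have "(\<lambda>h. \<Sum>i\<in>Basis. (Y x \<bullet> i) *\<^sub>R F' i h + (Y' h \<bullet> i) *\<^sub>R F x i)
      = (\<lambda>h. F' (Y x) h + F x (Y' h))"
    unfolding sum.distrib exp[OF S(2), of "Y' _"] by (subst F'_eq) (rule refl)
  ultimately show ?thesis by simp
qed

lemma differentiable_linear_slot:
  fixes F :: "'a::real_normed_vector \<Rightarrow> 'b::euclidean_space \<Rightarrow> 'c::real_normed_vector"
  assumes "open S" "x \<in> S" "\<And>y. y \<in> S \<Longrightarrow> linear (F y)"
    and "\<And>b. (\<lambda>y. F y b) differentiable (at x)" and "Y differentiable (at x)"
  shows "(\<lambda>y. F y (Y y)) differentiable (at x)"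
proof -
  have "((\<lambda>y. F y (Y y)) has_derivative
      (\<lambda>h. dderiv (\<lambda>y. F y (Y x)) x h + F x (dderiv Y x h))) (at x)"
    by (rule has_derivative_linear_slot[OF assms(1-3)])
      (use assms(4,5) in \<open>simp_all add: frechet_derivative_works\<close>)
  then show ?thesis by (rule differentiableI)
qed

lemma linear_derivative_slot:
  fixes F :: "'a::real_normed_vector \<Rightarrow> 'b::real_vector \<Rightarrow> 'c::real_normed_vector"
  assumes S: "open S" "x \<in> S" and lin: "\<And>y. y \<in> S \<Longrightarrow> linear (F y)"
    and F: "\<And>b. ((\<lambda>y. F y b) has_derivative F' b) (at x)"
  shows "linear (\<lambda>b. F' b h)"
proof (rule linearI)
  fix b c
  have "((\<lambda>y. F y b + F y c) has_derivative (\<lambda>h. F' b h + F' c h)) (at x)"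
    by (intro has_derivative_add F)
  then have "((\<lambda>y. F y (b + c)) has_derivative (\<lambda>h. F' b h + F' c h)) (at x)"
    by (rule has_derivative_transform_within_open[OF _ S]) (rule linear_add[OF lin, symmetric])
  from has_derivative_unique[OF F this] show "F' (b + c) h = F' b h + F' c h" by simp
next
  fix r b
  have "((\<lambda>y. r *\<^sub>R F y b) has_derivative (\<lambda>h. r *\<^sub>R F' b h)) (at x)"
    by (intro has_derivative_scaleR_right F)
  then have "((\<lambda>y. F y (r *\<^sub>R b)) has_derivative (\<lambda>h. r *\<^sub>R F' b h)) (at x)"
    by (rule has_derivative_transform_within_open[OF _ S]) (rule linear_cmul[OF lin, symmetric])
  from has_derivative_unique[OF F this] show "F' (r *\<^sub>R b) h = r *\<^sub>R F' b h" by simp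
qed

lemma smooth_on_differentiable:
  assumes "smooth_on S f" "x \<in> S"
  shows "f differentiable (at x)"
proof -
  have "Ck_on (Suc 0) S f" using assms(1) unfolding smooth_on_def by blast
  with assms(2) show ?thesis by simp
qed

lemma smooth_on_dderiv:
  assumes "smooth_on S f"
  shows "smooth_on S (\<lambda>y. dderiv f y v)"
  unfolding smooth_on_def
proof
  fix k
  have "Ck_on (Suc k) S f" using assms unfolding smooth_on_def by blast
  then show "Ck_on k S (\<lambda>y. dderiv f y v)" by simp
qed

lemma smooth_on_const:
  fixes c :: "'b::real_normed_vector"
  shows "smooth_on A (\<lambda>_. c)"
proof -
  have "Ck_on k A (\<lambda>_. c)" for k and c :: 'b
    by (induction k arbitrary: c) simp_all
  then show ?thesis unfolding smooth_on_def by blast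
qed

section \<open>The characteristic connection in an orthonormal frame\<close>

text \<open>What a single chart of the manifold supplies. Nondegeneracy of G is drawn from the
  orthonormal frame, see \<open>frame_expand\<close>.\<close>

locale framed_chart =
  fixes S :: "(real^'n) set" and G :: "real^'n \<Rightarrow> (real^'n) form2"
    and E :: "'n \<Rightarrow> real^'n \<Rightarrow> real^'n" and T :: "real^'n \<Rightarrow> (real^'n) form3"
  assumes open_S: "open S"
    and G_bilinear: "x \<in> S \<Longrightarrow> bilinear (G x)"
    and G_sym: "x \<in> S \<Longrightarrow> G x v w = G x w v"
    and G_smooth: "smooth_on S (\<lambda>x. G x v w)"
    and E_smooth: "smooth_on S (E a)"
    and orthonormal: "x \<in> S \<Longrightarrow> G x (E a x) (E b x) = (if a = b then 1 else 0)"
    and T_linear: "x \<in> S \<Longrightarrow> linear (\<lambda>u. T x u v w)"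
    and T_skew12: "x \<in> S \<Longrightarrow> T x u v w = - T x v u w"
    and T_skew23: "x \<in> S \<Longrightarrow> T x u v w = - T x u w v"
    and T_smooth: "smooth_on S (\<lambda>x. T x u v w)"
    and T_parallel: "\<lbrakk>smooth_on S Y; smooth_on S Z; smooth_on S W; x \<in> S\<rbrakk> \<Longrightarrow>
      char_nabla_T G T x v Y Z W = 0"
begin

definition dG :: "real^'n \<Rightarrow> real^'n \<Rightarrow> real^'n \<Rightarrow> real^'n \<Rightarrow> real" where
  "dG x v w z = dderiv (\<lambda>y. G y w z) x v"

definition dE :: "'n \<Rightarrow> real^'n \<Rightarrow> real^'n \<Rightarrow> real^'n" where
  "dE a x v = dderiv (E a) x v"

text \<open>\<open>conn x v w z\<close> is \<open>g(\<nabla>\<^sup>c\<^sub>v w, z)\<close> for a field \<open>w\<close> with constant coordinates.\<close>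

definition conn :: "real^'n \<Rightarrow> real^'n \<Rightarrow> real^'n \<Rightarrow> real^'n \<Rightarrow> real" where
  "conn x v w z = (1/2) * (dG x v w z + dG x w z v - dG x z v w) + (1/2) * T x v w z"

definition theta :: "'n \<Rightarrow> real^'n \<Rightarrow> real^'n \<Rightarrow> real" where
  "theta a x v = G x v (E a x)"

text \<open>The connection form \<open>g(\<nabla>\<^sup>c\<^sub>v e\<^sub>a, e\<^sub>b)\<close>.\<close>

definition omega :: "'n \<Rightarrow> 'n \<Rightarrow> real^'n \<Rightarrow> real^'n \<Rightarrow> real" where
  "omega a b x v = G x (dE a x v) (E b x) + conn x v (E a x) (E b x)"

text \<open>Not yet alternated: since v is constant in the coordinates,
  \<open>domega a b x u v - domega a b x v u\<close> is the exterior derivative of the connection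
  form.\<close>

definition domega :: "'n \<Rightarrow> 'n \<Rightarrow> real^'n \<Rightarrow> real^'n \<Rightarrow> real^'n \<Rightarrow> real" where
  "domega a b x u v = dderiv (\<lambda>y. omega a b y v) x u"

text \<open>The curvature form \<open>g(R\<^sup>c(u,v) e\<^sub>a, e\<^sub>b)\<close> of the connection form \<open>omega\<close>.\<close>

definition curv :: "'n \<Rightarrow> 'n \<Rightarrow> real^'n \<Rightarrow> real^'n \<Rightarrow> real^'n \<Rightarrow> real" where
  "curv a b x u v = domega a b x u v - domega a b x v u
    + (\<Sum>c\<in>UNIV. omega a c x v * omega c b x u - omega a c x u * omega c b x v)"

lemma G_linear_left: "x \<in> S \<Longrightarrow> linear (\<lambda>v. G x v w)"
  and G_linear_right: "x \<in> S \<Longrightarrow> linear (\<lambda>w. G x v w)"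
  using G_bilinear unfolding bilinear_def by blast+

lemma T_linear2: "x \<in> S \<Longrightarrow> linear (\<lambda>v. T x u v w)"
  using linear_compose_neg[OF T_linear[of x u w]] by (simp add: T_skew12[of x u])

lemma T_linear3: "x \<in> S \<Longrightarrow> linear (\<lambda>w. T x u v w)"
  using linear_compose_neg[OF T_linear2[of x u v]] by (simp add: T_skew23[of x u v])

lemma G_derivative: "x \<in> S \<Longrightarrow> ((\<lambda>y. G y w z) has_derivative (\<lambda>h. dG x h w z)) (at x)"
  using smooth_on_differentiable[OF G_smooth] by (simp add: dG_def frechet_derivative_works)

lemma E_derivative: "x \<in> S \<Longrightarrow> (E a has_derivative dE a x) (at x)"
  using smooth_on_differentiable[OF E_smooth] by (simp add: dE_def[abs_def] frechet_derivative_works)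

lemma dG_linear1: "x \<in> S \<Longrightarrow> linear (\<lambda>h. dG x h w z)"
  by (rule has_derivative_linear[OF G_derivative])

lemma dG_linear2: "x \<in> S \<Longrightarrow> linear (\<lambda>w. dG x h w z)"
  by (rule linear_derivative_slot[where F="\<lambda>y w. G y w z" and F'="\<lambda>w h. dG x h w z", OF open_S])
    (assumption | erule G_linear_left G_derivative)+

lemma dG_linear3: "x \<in> S \<Longrightarrow> linear (\<lambda>z. dG x h w z)"
  by (rule linear_derivative_slot[where F="\<lambda>y z. G y w z" and F'="\<lambda>z h. dG x h w z", OF open_S])
    (assumption | erule G_linear_right G_derivative)+

lemma dG_sym:
  assumes "x \<in> S" shows "dG x h w z = dG x h z w"
proof -
  have "((\<lambda>y. G y z w) has_derivative (\<lambda>h. dG x h w z)) (at x)"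
    by (rule has_derivative_transform_within_open[OF G_derivative[OF assms] open_S assms]) (rule G_sym)
  from has_derivative_unique[OF this G_derivative[OF assms]] show ?thesis by metis
qed

lemma conn_linear:
  assumes "x \<in> S"
  shows "linear (\<lambda>v. conn x v w z)" "linear (\<lambda>w. conn x v w z)" "linear (\<lambda>z. conn x v w z)"
  by (rule linearI; simp add: conn_def linear_add[OF dG_linear1] linear_add[OF dG_linear2] linear_add[OF dG_linear3]
      linear_add[OF T_linear] linear_add[OF T_linear2] linear_add[OF T_linear3]
      linear_cmul[OF dG_linear1] linear_cmul[OF dG_linear2] linear_cmul[OF dG_linear3]
      linear_cmul[OF T_linear] linear_cmul[OF T_linear2] linear_cmul[OF T_linear3] assms field_simps)+

lemma conn_torsion: "x \<in> S \<Longrightarrow> conn x u v z - conn x v u z = T x u v z"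
  by (simp add: conn_def dG_sym[of x u v z] dG_sym[of x v z u] dG_sym[of x z u v] T_skew12[of x v u z])

lemma conn_metric: "x \<in> S \<Longrightarrow> conn x v w z + conn x v z w = dG x v w z"
  by (simp add: conn_def dG_sym[of x w z v] dG_sym[of x z v w] dG_sym[of x v z w] T_skew23[of x v z w] field_simps)

text \<open>Orthonormality makes the map from coefficients to vectors injective, and equal
  dimensions then make it surjective.\<close>

lemma frame_expand:
  assumes x: "x \<in> S"
  shows "(\<Sum>a\<in>UNIV. theta a x z *\<^sub>R E a x) = z"
proof -
  define f where "f = (\<lambda>c::real^'n. \<Sum>a\<in>UNIV. c $ a *\<^sub>R E a x)"
  have lin: "linear f" unfolding f_def
    by (rule linearI) (simp_all add: scaleR_add_left sum.distrib scaleR_right.sum)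
  have coeff: "theta b x (f c) = c $ b" for b c
    unfolding theta_def f_def linear_sum[OF G_linear_left[OF x]] linear_cmul[OF G_linear_left[OF x]] orthonormal[OF x]
    by (simp add: if_distrib[of "(*) _"] cong: if_cong)
  have "inj f"
  proof (rule injI)
    fix c d assume "f c = f d"
    then have "c $ b = d $ b" for b using coeff[of b c] coeff[of b d] by simp
    then show "c = d" by (simp add: vec_eq_iff)
  qed
  then have "surj f" using linear_injective_imp_surjective[OF lin] by simp
  then obtain c where "z = f c" by (rule surjE)
  then show ?thesis by (simp only: coeff) (simp only: f_def)
qed

lemma linear_frame:
  fixes f :: "real^'n \<Rightarrow> real"
  assumes "x \<in> S" "linear f"
  shows "f z = (\<Sum>a\<in>UNIV. theta a x z * f (E a x))"
proof -
  have "f z = f (\<Sum>a\<in>UNIV. theta a x z *\<^sub>R E a x)" by (simp add: frame_expand[OF assms(1)])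
  then show ?thesis by (simp only: linear_sum[OF assms(2)] linear_cmul[OF assms(2)] real_scaleR_def)
qed

lemma theta_frame: "x \<in> S \<Longrightarrow> theta a x (E b x) = (if a = b then 1 else 0)"
  by (simp add: theta_def orthonormal)

lemma eq_from_theta:
  assumes "x \<in> S" "\<And>a. theta a x u = theta a x v"
  shows "u = v"
proof -
  have "u = (\<Sum>a\<in>UNIV. theta a x u *\<^sub>R E a x)" by (simp only: frame_expand[OF assms(1)])
  also have "\<dots> = v" by (simp only: assms(2) frame_expand[OF assms(1)])
  finally show ?thesis .
qed

text \<open>\<open>sharp\<close> is a definite description, so a representing vector has to be
  exhibited and shown to be unique; the frame provides both.\<close>

lemma sharp_inner:
  assumes x: "x \<in> S" and "linear \<alpha>"
  shows "G x (sharp G x \<alpha>) z = \<alpha> z"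
proof -
  define u where "u = (\<Sum>a\<in>UNIV. \<alpha> (E a x) *\<^sub>R E a x)"
  have u: "G x u z = \<alpha> z" for z
    unfolding u_def linear_sum[OF G_linear_left[OF x]] linear_cmul[OF G_linear_left[OF x]]
      linear_frame[OF assms, of z]
    by (simp add: theta_def G_sym[OF x, of z] mult.commute)
  have "sharp G x \<alpha> = u"
    unfolding sharp_def
  proof (rule the_equality)
    fix u' assume "\<forall>z. G x u' z = \<alpha> z"
    then show "u' = u" by (intro eq_from_theta[OF x]) (simp add: theta_def u)
  qed (simp add: u)
  then show ?thesis by (simp add: u)
qed

lemma torsion_vec_inner: "x \<in> S \<Longrightarrow> G x (torsion_vec G T x v w) z = T x v w z"
  unfolding torsion_vec_def by (rule sharp_inner) (auto intro: T_linear3)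

lemma christoffel_inner:
  assumes x: "x \<in> S"
  shows "G x (christoffel G x v w) z = (1/2) * (dG x v w z + dG x w z v - dG x z v w)"
proof -
  have "linear (\<lambda>z. (1/2) * (dG x v w z + dG x w z v - dG x z v w))"
    by (rule linearI) (simp_all add: linear_add[OF dG_linear1] linear_add[OF dG_linear2] linear_add[OF dG_linear3]
      linear_cmul[OF dG_linear1] linear_cmul[OF dG_linear2] linear_cmul[OF dG_linear3] x field_simps)
  from sharp_inner[OF x this] show ?thesis
    unfolding christoffel_def dG_def by simp
qed

lemma levi_civita_inner:
  assumes x: "x \<in> S"
  shows "G x (levi_civita G x v Y) z = G x (dderiv Y x v) z + conn x v (Y x) z - (1/2) * T x v (Y x) z"
  unfolding levi_civita_def linear_add[OF G_linear_left[OF x]] christoffel_inner[OF x] conn_def by simp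

text \<open>For s = 1/4 the torsion term has weight 1/2, which is the part of \<open>conn\<close>
  that the Levi-Civita connection lacks.\<close>

lemma char_nabla_inner:
  assumes x: "x \<in> S"
  shows "G x (char_nabla G T x v Y) z = G x (dderiv Y x v) z + conn x v (Y x) z"
  unfolding char_nabla_def nabla_def linear_add[OF G_linear_left[OF x]] linear_cmul[OF G_linear_left[OF x]]
    levi_civita_inner[OF x] torsion_vec_inner[OF x] by simp

lemma theta_char_nabla_frame: "x \<in> S \<Longrightarrow> theta b x (char_nabla G T x v (E a)) = omega a b x v"
  by (simp only: theta_def char_nabla_inner omega_def dE_def)

lemma theta_linear: "x \<in> S \<Longrightarrow> linear (theta a x)"
  unfolding theta_def[abs_def] by (rule G_linear_left)

lemma theta_frame_sum:
  assumes "x \<in> S" shows "theta b x (\<Sum>a\<in>UNIV. c a *\<^sub>R E a x) = c b"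
  unfolding linear_sum[OF theta_linear[OF assms]] linear_cmul[OF theta_linear[OF assms]] theta_frame[OF assms]
  by (simp add: if_distrib[of "(*) _"] cong: if_cong)

lemma char_nabla_frame:
  "x \<in> S \<Longrightarrow> char_nabla G T x v (E a) = (\<Sum>b\<in>UNIV. omega a b x v *\<^sub>R E b x)"
  by (rule eq_from_theta, assumption) (simp only: theta_char_nabla_frame theta_frame_sum)

lemma G_fields_derivative:
  assumes x: "x \<in> S" and Y: "(Y has_derivative Y') (at x)" and Z: "(Z has_derivative Z') (at x)"
  shows "((\<lambda>y. G y (Y y) (Z y)) has_derivative
    (\<lambda>h. dG x h (Y x) (Z x) + G x (Y' h) (Z x) + G x (Y x) (Z' h))) (at x)"
proof (rule has_derivative_linear_slot[OF open_S x _ _ Z])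
  show "((\<lambda>y. G y (Y y) c) has_derivative (\<lambda>h. dG x h (Y x) c + G x (Y' h) c)) (at x)" for c
    by (rule has_derivative_linear_slot[where F="\<lambda>y b. G y b c" and F'="\<lambda>b h. dG x h b c", OF open_S x _ _ Y])
      (simp_all add: G_linear_left G_derivative x)
qed (rule G_linear_right)

text \<open>The connection is metric: differentiate the constant functions g(e_a, e_b).\<close>

lemma omega_skew:
  assumes x: "x \<in> S" shows "omega a b x v = - omega b a x v"
proof -
  have "((\<lambda>y. if a = b then 1 else (0::real)) has_derivative
      (\<lambda>h. dG x h (E a x) (E b x) + G x (dE a x h) (E b x) + G x (E a x) (dE b x h))) (at x)"
    by (rule has_derivative_transform_within_open[OF G_fields_derivative[OF x E_derivative[OF x] E_derivative[OF x]] open_S x])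
      (rule orthonormal)
  from has_derivative_unique[OF this has_derivative_const]
  have "dG x v (E a x) (E b x) + G x (dE a x v) (E b x) + G x (E a x) (dE b x v) = 0" by metis
  then show ?thesis
    using conn_metric[OF x, of v "E a x" "E b x"] unfolding omega_def G_sym[OF x, of "E a x"] by simp
qed

lemma omega_linear: "x \<in> S \<Longrightarrow> linear (omega a b x)"
  unfolding omega_def[abs_def]
  by (rule linearI) (simp_all add: linear_add[OF conn_linear(1)] linear_cmul[OF conn_linear(1)]
      linear_add[OF has_derivative_linear[OF E_derivative]] linear_cmul[OF has_derivative_linear[OF E_derivative]]
      linear_add[OF G_linear_left] linear_cmul[OF G_linear_left] distrib_left)

text \<open>The form in which parallelism of T is used from here on. Differentiability needs its own
  argument, because parallelism only prescribes the value of the \<open>frechet_derivative\<close>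
  and not its existence.\<close>

lemma T_fields_derivative:
  assumes Y: "smooth_on S Y" and Z: "smooth_on S Z" and W: "smooth_on S W" and x: "x \<in> S"
  shows "((\<lambda>y. T y (Y y) (Z y) (W y)) has_derivative
    (\<lambda>u. T x (char_nabla G T x u Y) (Z x) (W x) + T x (Y x) (char_nabla G T x u Z) (W x)
      + T x (Y x) (Z x) (char_nabla G T x u W))) (at x)"
proof -
  have "(\<lambda>y. T y (Y y) (Z y) (W y)) differentiable (at x)"
  proof (rule differentiable_linear_slot[OF open_S x _ _ smooth_on_differentiable[OF W x]])
    show "(\<lambda>y. T y (Y y) (Z y) c) differentiable (at x)" for c
    proof (rule differentiable_linear_slot[where F="\<lambda>y b. T y (Y y) b c", OF open_S x _ _ smooth_on_differentiable[OF Z x]])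
      show "(\<lambda>y. T y (Y y) b c) differentiable (at x)" for b
        by (rule differentiable_linear_slot[where F="\<lambda>y a. T y a b c", OF open_S x _ _ smooth_on_differentiable[OF Y x]])
          (erule T_linear, rule smooth_on_differentiable[OF T_smooth x])
    qed (rule T_linear2)
  qed (rule T_linear3)
  then have d: "((\<lambda>y. T y (Y y) (Z y) (W y)) has_derivative dderiv (\<lambda>y. T y (Y y) (Z y) (W y)) x) (at x)"
    by (simp add: frechet_derivative_works)
  have "dderiv (\<lambda>y. T y (Y y) (Z y) (W y)) x
     = (\<lambda>u. T x (char_nabla G T x u Y) (Z x) (W x) + T x (Y x) (char_nabla G T x u Z) (W x)
      + T x (Y x) (Z x) (char_nabla G T x u W))"
  proof
    fix u
    show "dderiv (\<lambda>y. T y (Y y) (Z y) (W y)) x u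
     = T x (char_nabla G T x u Y) (Z x) (W x) + T x (Y x) (char_nabla G T x u Z) (W x)
      + T x (Y x) (Z x) (char_nabla G T x u W)"
      using T_parallel[OF Y Z W x, of u] by (simp add: char_nabla_T_def)
  qed
  with d show ?thesis by simp
qed

section \<open>Structure equations and the first Bianchi identity\<close>

definition dtheta :: "'n \<Rightarrow> real^'n \<Rightarrow> real^'n \<Rightarrow> real^'n \<Rightarrow> real" where
  "dtheta a x u v = dG x u v (E a x) + G x v (dE a x u)"

lemma theta_derivative:
  assumes x: "x \<in> S"
  shows "((\<lambda>y. theta a y v) has_derivative (\<lambda>u. dtheta a x u v)) (at x)"
  using G_fields_derivative[OF x has_derivative_const E_derivative[OF x], of v a]
  unfolding theta_def dtheta_def linear_0[OF G_linear_left[OF x]] by simp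

lemma G_expand: "x \<in> S \<Longrightarrow> G x p q = (\<Sum>b\<in>UNIV. theta b x p * theta b x q)"
  using linear_frame[OF _ G_linear_right, of x x p q]
  by (simp add: theta_def mult.commute)

text \<open>Metricity again: the derivative of g(v, e_a) for constant v splits into g(nabla^c_u v,
  e_a) and g(v, nabla^c_u e_a).\<close>

lemma dtheta_eq:
  assumes x: "x \<in> S"
  shows "dtheta a x u v = conn x u v (E a x) + (\<Sum>b\<in>UNIV. omega a b x u * theta b x v)"
proof -
  have "(\<Sum>b\<in>UNIV. omega a b x u * theta b x v) = G x (char_nabla G T x u (E a)) v"
    by (simp only: G_expand[OF x] theta_char_nabla_frame[OF x])
  also have "\<dots> = G x (dE a x u) v + conn x u (E a x) v"
    by (simp only: char_nabla_inner[OF x] dE_def)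
  finally show ?thesis
    using conn_metric[OF x, of u v "E a x"] G_sym[OF x, of v "dE a x u"] by (simp add: dtheta_def)
qed

text \<open>Cartan's first structure equation: the Christoffel part of \<open>conn\<close> is
  symmetric, so that only the torsion survives the alternation.\<close>

lemma dtheta_skew:
  assumes x: "x \<in> S"
  shows "dtheta a x u v - dtheta a x v u = T x u v (E a x)
    + (\<Sum>b\<in>UNIV. omega a b x u * theta b x v - omega a b x v * theta b x u)"
  using conn_torsion[OF x, of u v "E a x"] by (simp add: dtheta_eq[OF x] sum_subtractf)

lemma dG_differentiable: "x \<in> S \<Longrightarrow> (\<lambda>y. dG y v w z) differentiable (at x)"
  unfolding dG_def by (rule smooth_on_differentiable[OF smooth_on_dderiv[OF G_smooth]])

lemma dE_differentiable: "x \<in> S \<Longrightarrow> (\<lambda>y. dE a y v) differentiable (at x)"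
  unfolding dE_def by (rule smooth_on_differentiable[OF smooth_on_dderiv[OF E_smooth]])

lemma E_differentiable: "x \<in> S \<Longrightarrow> E a differentiable (at x)"
  by (rule smooth_on_differentiable[OF E_smooth])

lemma G_differentiable: "x \<in> S \<Longrightarrow> (\<lambda>y. G y v w) differentiable (at x)"
  by (rule smooth_on_differentiable[OF G_smooth])

lemma dtheta_differentiable:
  assumes x: "x \<in> S"
  shows "(\<lambda>y. dtheta a y u v) differentiable (at x)"
  unfolding dtheta_def
proof (rule differentiable_add)
  show "(\<lambda>y. dG y u v (E a y)) differentiable at x"
    by (rule differentiable_linear_slot[where F="\<lambda>y b. dG y u v b", OF open_S x _ _ E_differentiable[OF x]])
      (erule dG_linear3, rule dG_differentiable[OF x])
  show "(\<lambda>y. G y v (dE a y u)) differentiable at x"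
    by (rule differentiable_linear_slot[where F="\<lambda>y b. G y v b", OF open_S x _ _ dE_differentiable[OF x]])
      (erule G_linear_right, rule G_differentiable[OF x])
qed

lemma conn_differentiable:
  assumes x: "x \<in> S"
  shows "(\<lambda>y. conn y v w z) differentiable (at x)"
proof -
  show ?thesis unfolding conn_def
    by (intro differentiable_add differentiable_diff differentiable_mult differentiable_const
        dG_differentiable[OF x] smooth_on_differentiable[OF T_smooth x])
qed

lemma omega_differentiable:
  assumes x: "x \<in> S"
  shows "(\<lambda>y. omega a b y v) differentiable (at x)"
  unfolding omega_def
proof (rule differentiable_add)
  show "(\<lambda>y. G y (dE a y v) (E b y)) differentiable at x"
  proof (rule differentiable_linear_slot[where F="\<lambda>y c. G y (dE a y v) c", OF open_S x _ _ E_differentiable[OF x]])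
    show "(\<lambda>y. G y (dE a y v) c) differentiable at x" for c
      by (rule differentiable_linear_slot[where F="\<lambda>y b. G y b c", OF open_S x _ _ dE_differentiable[OF x]])
        (erule G_linear_left, rule G_differentiable[OF x])
  qed (erule G_linear_right)
  show "(\<lambda>y. conn y v (E a y) (E b y)) differentiable at x"
  proof (rule differentiable_linear_slot[where F="\<lambda>y c. conn y v (E a y) c", OF open_S x _ _ E_differentiable[OF x]])
    show "(\<lambda>y. conn y v (E a y) c) differentiable at x" for c
      by (rule differentiable_linear_slot[where F="\<lambda>y b. conn y v b c", OF open_S x _ _ E_differentiable[OF x]])
        (erule conn_linear, rule conn_differentiable[OF x])
  qed (erule conn_linear)
qed

lemma omega_derivative:
  "x \<in> S \<Longrightarrow> ((\<lambda>y. omega a b y v) has_derivative (\<lambda>u. domega a b x u v)) (at x)"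
  using omega_differentiable by (simp add: domega_def frechet_derivative_works)

lemma domega_skew:
  assumes x: "x \<in> S" shows "domega a b x u v = - domega b a x u v"
proof -
  have "((\<lambda>y. omega a b y v) has_derivative (\<lambda>u. - domega b a x u v)) (at x)"
    by (rule has_derivative_transform_within_open[OF has_derivative_minus[OF omega_derivative[OF x]] open_S x])
      (rule omega_skew[symmetric])
  from has_derivative_unique[OF omega_derivative[OF x] this] show ?thesis by metis
qed

lemma curv_skew:
  assumes x: "x \<in> S" shows "curv a b x u v = - curv b a x u v"
proof -
  have s: "omega a c x v * omega c b x u = omega b c x u * omega c a x v" for u v c
    using omega_skew[OF x, of a c v] omega_skew[OF x, of c b u] by simp
  show ?thesis
    using domega_skew[OF x, of a b u v] domega_skew[OF x, of a b v u]
    unfolding curv_def s sum_subtractf by simp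
qed

lemma curv_skew_args: "curv a b x u v = - curv a b x v u"
  by (simp add: curv_def sum_subtractf)

text \<open>Constant coordinate fields commute, so the torsion has no bracket term.\<close>

lemma const_nabla_torsion:
  assumes x: "x \<in> S"
  shows "char_nabla G T x u (\<lambda>_. v) - char_nabla G T x v (\<lambda>_. u) = torsion_vec G T x u v"
  by (rule eq_from_theta[OF x])
    (simp add: theta_def linear_diff[OF G_linear_left[OF x]] char_nabla_inner[OF x] torsion_vec_inner[OF x]
      conn_torsion[OF x])

lemma T_char_nabla_frame:
  assumes x: "x \<in> S"
  shows "T x v w (char_nabla G T x u (E a)) = (\<Sum>b\<in>UNIV. omega a b x u * T x v w (E b x))"
  unfolding char_nabla_frame[OF x] linear_sum[OF T_linear3[OF x]] linear_cmul[OF T_linear3[OF x]] by simp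

text \<open>The exterior derivative of the first structure equation. As T is parallel, the usual
  term with nabla^c T is absent and the right-hand side is quadratic in T. Its sign reflects
  g(R(u,v) e_a, w) = - g(R(u,v) w, e_a).\<close>

lemma first_bianchi:
  assumes x: "x \<in> S"
  shows "(\<Sum>b\<in>UNIV. curv a b x u v * theta b x w + curv a b x v w * theta b x u + curv a b x w u * theta b x v)
    = - (T x (torsion_vec G T x u v) w (E a x) + T x (torsion_vec G T x v w) u (E a x)
       + T x (torsion_vec G T x w u) v (E a x))"
proof -
  define d2 where "d2 v w u = dderiv (\<lambda>y. dtheta a y v w) x u" for v w u
  have d2: "((\<lambda>y. dtheta a y v w) has_derivative d2 v w) (at x)" for v w
    using dtheta_differentiable[OF x] by (simp add: frechet_derivative_works d2_def[abs_def])
  \<comment> \<open>Commuting second derivatives of the coframe, that is, d d = 0.\<close>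
  have schwarz: "d2 v w u = d2 u w v" for u v w
    by (rule second_derivative_symmetric_real[OF open_S x, of "\<lambda>y. theta a y w" "\<lambda>y v. dtheta a y v w"])
      (assumption | rule d2 | erule theta_derivative)+
  define nab where "nab u v = char_nabla G T x u (\<lambda>_. v)" for u v
  define H where "H b v w = (\<Sum>c\<in>UNIV. omega b c x v * theta c x w - omega b c x w * theta c x v)" for b v w
  \<comment> \<open>\<open>Tp\<close> collects the terms in which the constant arguments of T are
    differentiated covariantly, \<open>L\<close> everything that is summed over the frame.\<close>
  define Tp where "Tp u v w = T x (nab u v) w (E a x) + T x v (nab u w) (E a x)" for u v w
  define L where "L u v w b = omega a b x u * T x v w (E b x)
      + (domega a b x u v * theta b x w + omega a b x v * dtheta b x u w)
      - (domega a b x u w * theta b x v + omega a b x w * dtheta b x u v)" for u v w b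
  have eq: "d2 v w u - d2 w v u = Tp u v w + (\<Sum>b\<in>UNIV. L u v w b)" for u v w
  proof -
    have "((\<lambda>y. T y v w (E a y) + (\<Sum>b\<in>UNIV. omega a b y v * theta b y w - omega a b y w * theta b y v))
      has_derivative (\<lambda>u. (T x (nab u v) w (E a x) + T x v (nab u w) (E a x) + T x v w (char_nabla G T x u (E a)))
        + (\<Sum>b\<in>UNIV. (omega a b x v * dtheta b x u w + domega a b x u v * theta b x w)
            - (omega a b x w * dtheta b x u v + domega a b x u w * theta b x v)))) (at x)"
      unfolding nab_def
      by (intro has_derivative_add has_derivative_sum has_derivative_diff has_derivative_mult
          omega_derivative[OF x] theta_derivative[OF x] T_fields_derivative[OF smooth_on_const smooth_on_const E_smooth x])
    then have "((\<lambda>y. dtheta a y v w - dtheta a y w v)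
      has_derivative (\<lambda>u. (T x (nab u v) w (E a x) + T x v (nab u w) (E a x) + T x v w (char_nabla G T x u (E a)))
        + (\<Sum>b\<in>UNIV. (omega a b x v * dtheta b x u w + domega a b x u v * theta b x w)
            - (omega a b x w * dtheta b x u v + domega a b x u w * theta b x v)))) (at x)"
      by (rule has_derivative_transform_within_open[OF _ open_S x]) (rule dtheta_skew[symmetric])
    from has_derivative_unique[OF has_derivative_diff[OF d2 d2] this, THEN fun_cong, of u]
    show ?thesis
      by (simp add: T_char_nabla_frame[OF x] Tp_def L_def sum.distrib sum_subtractf)
  qed
  have cyc: "Tp u v w + Tp v w u + Tp w u v + (\<Sum>b\<in>UNIV. L u v w b + L v w u b + L w u v b) = 0"
    using eq[of v w u] eq[of w u v] eq[of u v w] schwarz[of v w u] schwarz[of w v u] schwarz[of w u v]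
    by (simp add: sum.distrib)
  have tors: "nab u v = nab v u + torsion_vec G T x u v" for u v
    using const_nabla_torsion[OF x, of u v] by (simp add: nab_def algebra_simps)
  \<comment> \<open>In the cyclic sum \<open>nab u v\<close> and \<open>nab v u\<close> enter T with
    opposite signs, and their difference is the torsion.\<close>
  have Tcyc: "Tp u v w + Tp v w u + Tp w u v = T x (torsion_vec G T x u v) w (E a x)
       + T x (torsion_vec G T x v w) u (E a x) + T x (torsion_vec G T x w u) v (E a x)"
    unfolding Tp_def tors[of u v] tors[of v w] tors[of w u] linear_add[OF T_linear[OF x]]
    using T_skew12[OF x, of v "nab u w"] T_skew12[OF x, of w "nab v u"] T_skew12[OF x, of u "nab w v"]
    by simp
  define Q where "Q b u v = (\<Sum>c\<in>UNIV. omega a c x u * omega c b x v)" for b u v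
  have Q: "(\<Sum>b\<in>UNIV. omega a b x u * H b v w) = (\<Sum>b\<in>UNIV. Q b u v * theta b x w - Q b u w * theta b x v)" for u v w
  proof -
    have "(\<Sum>b\<in>UNIV. omega a b x u * H b v w)
      = (\<Sum>b\<in>UNIV. \<Sum>c\<in>UNIV. omega a b x u * omega b c x v * theta c x w - omega a b x u * omega b c x w * theta c x v)"
      by (simp add: H_def sum_distrib_left right_diff_distrib mult.assoc)
    also have "\<dots> = (\<Sum>c\<in>UNIV. \<Sum>b\<in>UNIV. omega a b x u * omega b c x v * theta c x w - omega a b x u * omega b c x w * theta c x v)"
      by (rule sum.swap)
    finally show ?thesis by (simp add: Q_def sum_distrib_right sum_subtractf)
  qed
  have curv_Q: "curv a b x u v = domega a b x u v - domega a b x v u + Q b v u - Q b u v" for b u v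
    by (simp add: curv_def Q_def sum_subtractf)
  have "L u v w b + L v w u b + L w u v b
     = (domega a b x u v - domega a b x v u) * theta b x w
       + (domega a b x v w - domega a b x w v) * theta b x u
       + (domega a b x w u - domega a b x u w) * theta b x v
       - (omega a b x u * H b v w + omega a b x v * H b w u + omega a b x w * H b u v)" for b
  proof -
    \<comment> \<open>Using the structure equation a second time removes T and cancels all products
      of \<open>omega\<close> with \<open>dtheta\<close>. What remains are the linear and quadratic
      parts of the curvature, multiplied by \<open>theta\<close>.\<close>
    have e: "T x v w (E b x) = dtheta b x v w - dtheta b x w v - H b v w" for v w
      using dtheta_skew[OF x, of b v w] by (simp add: H_def)
    show ?thesis unfolding L_def e by (simp add: algebra_simps)
  qed
  then have "(\<Sum>b\<in>UNIV. L u v w b + L v w u b + L w u v b)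
     = (\<Sum>b\<in>UNIV. (domega a b x u v - domega a b x v u) * theta b x w
       + (domega a b x v w - domega a b x w v) * theta b x u
       + (domega a b x w u - domega a b x u w) * theta b x v)
       - ((\<Sum>b\<in>UNIV. omega a b x u * H b v w) + (\<Sum>b\<in>UNIV. omega a b x v * H b w u)
         + (\<Sum>b\<in>UNIV. omega a b x w * H b u v))"
    by (simp only: sum.distrib sum_subtractf)
  also have "\<dots> = (\<Sum>b\<in>UNIV. curv a b x u v * theta b x w + curv a b x v w * theta b x u + curv a b x w u * theta b x v)"
    unfolding Q sum.distrib[symmetric] sum_subtractf[symmetric]
    by (rule sum.cong[OF refl]) (simp add: curv_Q algebra_simps)
  finally show ?thesis using cyc Tcyc by simp
qed

section \<open>Curvature and Ricci tensor in the frame, and the cyclic identity\<close>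

lemma char_nabla_char_nabla_frame:
  assumes x: "x \<in> S" and Y: "(Y has_derivative Y') (at x)"
  shows "G x (char_nabla G T x v (\<lambda>y. char_nabla G T y (Y y) (E b))) (E d x)
    = domega b d x v (Y x) + omega b d x (Y' v) + (\<Sum>c\<in>UNIV. omega b c x (Y x) * omega c d x v)"
proof -
  have om: "((\<lambda>y. omega b c y (Y y)) has_derivative (\<lambda>h. domega b c x h (Y x) + omega b c x (Y' h))) (at x)" for c
    by (rule has_derivative_linear_slot[where F'="\<lambda>v h. domega b c x h v", OF open_S x _ _ Y])
      (erule omega_linear, rule omega_derivative[OF x])
  have "((\<lambda>y. \<Sum>c\<in>UNIV. omega b c y (Y y) *\<^sub>R E c y) has_derivative
     (\<lambda>h. \<Sum>c\<in>UNIV. omega b c x (Y x) *\<^sub>R dE c x h + (domega b c x h (Y x) + omega b c x (Y' h)) *\<^sub>R E c x)) (at x)"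
    by (intro has_derivative_sum has_derivative_scaleR om E_derivative[OF x])
  then have "((\<lambda>y. char_nabla G T y (Y y) (E b)) has_derivative
     (\<lambda>h. \<Sum>c\<in>UNIV. omega b c x (Y x) *\<^sub>R dE c x h + (domega b c x h (Y x) + omega b c x (Y' h)) *\<^sub>R E c x)) (at x)"
    by (rule has_derivative_transform_within_open[OF _ open_S x]) (rule char_nabla_frame[symmetric])
  from frechet_derivative_at[OF this, symmetric, THEN fun_cong]
  have D: "dderiv (\<lambda>y. char_nabla G T y (Y y) (E b)) x v
     = (\<Sum>c\<in>UNIV. omega b c x (Y x) *\<^sub>R dE c x v + (domega b c x v (Y x) + omega b c x (Y' v)) *\<^sub>R E c x)" .
  have "G x (char_nabla G T x v (\<lambda>y. char_nabla G T y (Y y) (E b))) (E d x)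
     = (\<Sum>c\<in>UNIV. omega b c x (Y x) * G x (dE c x v) (E d x)
        + (domega b c x v (Y x) + omega b c x (Y' v)) * (if c = d then 1 else 0))
      + (\<Sum>c\<in>UNIV. omega b c x (Y x) * conn x v (E c x) (E d x))"
    unfolding char_nabla_inner[OF x] D char_nabla_frame[OF x] linear_sum[OF G_linear_left[OF x]]
      linear_add[OF G_linear_left[OF x]] linear_cmul[OF G_linear_left[OF x]] linear_sum[OF conn_linear(2)[OF x]]
      linear_cmul[OF conn_linear(2)[OF x]] orthonormal[OF x] by simp
  also have "\<dots> = (\<Sum>c\<in>UNIV. (domega b c x v (Y x) + omega b c x (Y' v)) * (if c = d then 1 else 0))
      + (\<Sum>c\<in>UNIV. omega b c x (Y x) * omega c d x v)"
    by (simp add: omega_def[of _ d] sum.distrib distrib_left)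
  finally show ?thesis by (simp add: if_distrib[of "(*) _"] cong: if_cong)
qed

text \<open>The derivatives of the fields X and Y cancel against the bracket term, so the curvature
  defined through fields is the tensorial form \<open>curv\<close>.\<close>

lemma char_curv_inner:
  assumes x: "x \<in> S" and X: "X differentiable (at x)" and Y: "Y differentiable (at x)"
  shows "G x (char_curv G T X Y (E b) x) (E d x) = curv b d x (X x) (Y x)"
proof -
  have X': "(X has_derivative dderiv X x) (at x)" and Y': "(Y has_derivative dderiv Y x) (at x)"
    using X Y by (simp_all add: frechet_derivative_works)
  have br: "G x (char_nabla G T x (lie_bracket X Y x) (E b)) (E d x)
      = omega b d x (dderiv Y x (X x)) - omega b d x (dderiv X x (Y x))"
    using theta_char_nabla_frame[OF x, of d "lie_bracket X Y x" b]
    by (simp add: theta_def lie_bracket_def linear_diff[OF omega_linear[OF x]])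
  show ?thesis
    unfolding char_curv_def linear_diff[OF G_linear_left[OF x]] br
      char_nabla_char_nabla_frame[OF x X'] char_nabla_char_nabla_frame[OF x Y']
    by (simp add: curv_def sum_subtractf)
qed

lemma theta_char_Ric_endo:
  assumes x: "x \<in> S" and X: "X differentiable (at x)"
  shows "theta b x (char_Ric_endo G T E X x) = (\<Sum>m\<in>UNIV. curv b m x (E m x) (X x))"
  unfolding char_Ric_endo_def theta_frame_sum[OF x] char_Ric_def char_curv_inner[OF x E_differentiable[OF x] X] ..

text \<open>The frame components of v _| sigma_T. The factor 1/2 of sigma_T has disappeared because
  the wedge square of a 2-form contains each product twice.\<close>

definition sigma_comp :: "real^'n \<Rightarrow> real^'n \<Rightarrow> 'n \<Rightarrow> 'n \<Rightarrow> 'n \<Rightarrow> real" where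
  "sigma_comp x v k a b = (\<Sum>m\<in>UNIV. T x v (E k x) (E m x) * T x (E m x) (E a x) (E b x)
    + T x v (E a x) (E m x) * T x (E m x) (E b x) (E k x)
    + T x v (E b x) (E m x) * T x (E m x) (E k x) (E a x))"

lemma sigma_comp_cyclic: "sigma_comp x v k a b = sigma_comp x v a b k"
  by (simp add: sigma_comp_def add_ac)

lemma T_cyclic: "x \<in> S \<Longrightarrow> T x u v w = T x v w u"
  using T_skew12[of x u v w] T_skew23[of x v u w] by simp

lemma sigma_form_eq:
  assumes x: "x \<in> S"
  shows "sigma_form E T x v (E k x) (E a x) (E b x) = sigma_comp x v k a b"
  unfolding sigma_form_def sigma_comp_def sum_distrib_left
proof (rule sum.cong[OF refl])
  fix m
  have c: "T x (E m x) v w = T x v w (E m x)" for w by (rule T_cyclic[OF x])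
  have s: "T x (E m x) (E k x) (E b x) = - T x (E m x) (E b x) (E k x)" by (rule T_skew23[OF x])
  show "1/2 * wedge22 (T x (E m x)) (T x (E m x)) v (E k x) (E a x) (E b x)
     = T x v (E k x) (E m x) * T x (E m x) (E a x) (E b x)
    + T x v (E a x) (E m x) * T x (E m x) (E b x) (E k x)
    + T x v (E b x) (E m x) * T x (E m x) (E k x) (E a x)"
    unfolding wedge22_def c s by (simp add: algebra_simps)
qed

lemma T_torsion_vec:
  assumes x: "x \<in> S"
  shows "T x (torsion_vec G T x u v) w z = (\<Sum>m\<in>UNIV. T x u v (E m x) * T x (E m x) w z)"
  using linear_frame[OF x T_linear[OF x], of "torsion_vec G T x u v" w z]
  by (simp add: theta_def torsion_vec_inner[OF x])

text \<open>Bianchi gives the cyclic sum over the first three slots; the pair symmetry that turns it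
  into the cyclic sum over the last three is absorbed in the combination of instances used here.\<close>

lemma curv_cyclic:
  assumes x: "x \<in> S"
  shows "curv a b x v (E k x) + curv b k x v (E a x) + curv k a x v (E b x) = sigma_comp x v k a b"
proof -
  \<comment> \<open>\<open>Y k l a\<close> is g(R(e_k, e_l) e_a, v), a term in which v is not an
    argument of the curvature 2-form.\<close>
  define Y where "Y k l a = (\<Sum>b\<in>UNIV. curv a b x (E k x) (E l x) * theta b x v)" for k l a
  have pick: "(\<Sum>b\<in>UNIV. f b * theta b x (E l x)) = f l" for f l
    by (simp add: theta_frame[OF x] if_distrib[of "(*) _"] cong: if_cong)
  have c: "T x (E m x) v w = T x v w (E m x)" for w m by (rule T_cyclic[OF x])
  have inst: "curv a l x v (E k x) + Y k l a - curv a k x v (E l x) = - sigma_comp x v k l a" for k l a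
  proof -
    have "curv a l x v (E k x) + Y k l a + curv a k x (E l x) v
      = - ((\<Sum>m\<in>UNIV. T x v (E k x) (E m x) * T x (E m x) (E l x) (E a x))
         + (\<Sum>m\<in>UNIV. T x (E k x) (E l x) (E m x) * T x (E m x) v (E a x))
         + (\<Sum>m\<in>UNIV. T x (E l x) v (E m x) * T x (E m x) (E k x) (E a x)))"
      using first_bianchi[OF x, of a v "E k x" "E l x"]
      by (simp only: sum.distrib pick Y_def T_torsion_vec[OF x])
    also have "\<dots> = - sigma_comp x v k l a"
      unfolding sigma_comp_def sum.distrib[symmetric] neg_equal_iff_equal
    proof (rule sum.cong[OF refl])
      fix m
      show "T x v (E k x) (E m x) * T x (E m x) (E l x) (E a x)
        + T x (E k x) (E l x) (E m x) * T x (E m x) v (E a x)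
        + T x (E l x) v (E m x) * T x (E m x) (E k x) (E a x)
        = T x v (E k x) (E m x) * T x (E m x) (E l x) (E a x)
        + T x v (E l x) (E m x) * T x (E m x) (E a x) (E k x)
        + T x v (E a x) (E m x) * T x (E m x) (E k x) (E l x)"
        unfolding c T_skew23[OF x, of v "E m x" "E l x"] T_skew23[OF x, of "E m x" "E k x" "E a x"]
          T_cyclic[OF x, of "E m x" "E k x" "E l x"] by simp
    qed
    finally show ?thesis by (simp add: curv_skew_args[of a k x "E l x" v])
  qed
  \<comment> \<open>The Bianchi identity for three frame vectors, with its free index contracted
    against v: here v occurs in \<open>Y\<close> terms only.\<close>
  have trace: "Y k l p + Y l p k + Y p k l = - sigma_comp x v k l p" for k l p
  proof -
    have frame: "curv a p x (E k x) (E l x) + curv a k x (E l x) (E p x) + curv a l x (E p x) (E k x)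
      = - (T x (torsion_vec G T x (E k x) (E l x)) (E p x) (E a x)
         + T x (torsion_vec G T x (E l x) (E p x)) (E k x) (E a x)
         + T x (torsion_vec G T x (E p x) (E k x)) (E l x) (E a x))" for a
      using first_bianchi[OF x, of a "E k x" "E l x" "E p x"] by (simp only: sum.distrib pick)
    have neg: "(\<Sum>a\<in>UNIV. theta a x v * curv a p x u w) = - (\<Sum>a\<in>UNIV. curv p a x u w * theta a x v)" for p u w
      unfolding sum_negf[symmetric] by (intro sum.cong refl) (simp add: curv_skew[OF x, of _ p])
    have TT: "(\<Sum>a\<in>UNIV. theta a x v * T x (torsion_vec G T x u w) z (E a x))
        = - (\<Sum>m\<in>UNIV. T x v z (E m x) * T x (E m x) u w)" for u w z
    proof -
      have "(\<Sum>a\<in>UNIV. theta a x v * T x (torsion_vec G T x u w) z (E a x)) = T x (torsion_vec G T x u w) z v"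
        by (rule linear_frame[OF x T_linear3[OF x], symmetric])
      also have "\<dots> = - (\<Sum>m\<in>UNIV. T x v z (E m x) * T x (E m x) u w)"
        unfolding T_torsion_vec[OF x] sum_negf[symmetric]
      proof (rule sum.cong[OF refl])
        fix m
        show "T x u w (E m x) * T x (E m x) z v = - (T x v z (E m x) * T x (E m x) u w)"
          using T_cyclic[OF x, of "E m x" u w] T_skew23[OF x, of "E m x" z v] c[of m z] by simp
      qed
      finally show ?thesis .
    qed
    have "(\<Sum>a\<in>UNIV. theta a x v * (curv a p x (E k x) (E l x) + curv a k x (E l x) (E p x) + curv a l x (E p x) (E k x)))
      = - (Y k l p + Y l p k + Y p k l)"
      unfolding distrib_left sum.distrib neg by (simp add: Y_def)
    moreover have "(\<Sum>a\<in>UNIV. theta a x v * (curv a p x (E k x) (E l x) + curv a k x (E l x) (E p x) + curv a l x (E p x) (E k x)))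
      = sigma_comp x v k l p"
      unfolding frame mult_minus_right sum_negf distrib_left sum.distrib TT
      by (simp add: sigma_comp_def sum.distrib)
    ultimately show ?thesis by simp
  qed
  \<comment> \<open>Let C be the left-hand side. The three instances of \<open>inst\<close> add up
    to -2 C plus the \<open>Y\<close> terms, and equal -3 times \<open>sigma_comp\<close>. By
    \<open>trace\<close> the \<open>Y\<close> terms are minus \<open>sigma_comp\<close>, whence C is
    \<open>sigma_comp\<close>.\<close>
  show ?thesis
    using inst[of b a k] inst[of k b a] inst[of a k b] trace[of k a b] sigma_comp_cyclic[of x v k a b] sigma_comp_cyclic[of x v a b k]
      curv_skew[OF x, of b a v "E k x"] curv_skew[OF x, of k b v "E a x"] curv_skew[OF x, of a k v "E b x"]
    by linarith
qed

end

section \<open>Contractions in the Clifford algebra\<close>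

lemma sum3_rotate:
  fixes f :: "'n::finite \<Rightarrow> 'n \<Rightarrow> 'n \<Rightarrow> 'r::comm_monoid_add"
  shows "(\<Sum>k\<in>UNIV. \<Sum>a\<in>UNIV. \<Sum>b\<in>UNIV. f a b k) = (\<Sum>k\<in>UNIV. \<Sum>a\<in>UNIV. \<Sum>b\<in>UNIV. f k a b)"
  by (subst sum.swap, rule sum.cong[OF refl], rule sum.swap)

text \<open>Stated for an arbitrary real algebra so that ring normalisation applies; the Clifford
  matrices enter later through \<open>cmat\<close>.\<close>

locale clifford_frame =
  fixes \<gamma> :: "'n::finite \<Rightarrow> 'r::real_algebra_1"
  assumes clifford_rel: "\<gamma> a * \<gamma> b + \<gamma> b * \<gamma> a = (if a = b then - 2 else 0)"
begin

definition cvec :: "('n \<Rightarrow> real) \<Rightarrow> 'r" where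
  "cvec u = (\<Sum>a\<in>UNIV. u a *\<^sub>R \<gamma> a)"

definition ctwo :: "('n \<Rightarrow> 'n \<Rightarrow> real) \<Rightarrow> 'r" where
  "ctwo t = (1/2) *\<^sub>R (\<Sum>a\<in>UNIV. \<Sum>b\<in>UNIV. t a b *\<^sub>R (\<gamma> a * \<gamma> b))"

text \<open>There is no factor 1/6, because the coefficients are often skew in the last two slots
  only. For a 3-form this is six times its Clifford action.\<close>

definition cthree :: "('n \<Rightarrow> 'n \<Rightarrow> 'n \<Rightarrow> real) \<Rightarrow> 'r" where
  "cthree q = (\<Sum>k\<in>UNIV. \<Sum>a\<in>UNIV. \<Sum>b\<in>UNIV. q k a b *\<^sub>R (\<gamma> k * \<gamma> a * \<gamma> b))"

lemma gamma_swap: "\<gamma> a * \<gamma> b = (if a = b then - 2 else 0) - \<gamma> b * \<gamma> a"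
  using clifford_rel[of a b] by (simp add: algebra_simps split: if_splits)

lemma gamma_sq: "\<gamma> a * \<gamma> a = - 1"
proof -
  have "(2::real) *\<^sub>R (\<gamma> a * \<gamma> a) = (2::real) *\<^sub>R (- 1)"
    using clifford_rel[of a a] by (simp add: scaleR_2)
  then show ?thesis by (metis real_vector.scale_left_imp_eq zero_neq_numeral)
qed

lemma gamma_swap_left: "x * \<gamma> a * \<gamma> b = (if a = b then - 2 *\<^sub>R x else 0) - x * \<gamma> b * \<gamma> a"
proof -
  have "x * \<gamma> a * \<gamma> b = x * ((if a = b then - 2 else 0) - \<gamma> b * \<gamma> a)"
    unfolding mult.assoc gamma_swap[of a b] ..
  then show ?thesis by (simp add: right_diff_distrib mult.assoc scaleR_2 mult_2_right)
qed

lemma gamma_swap_right: "\<gamma> a * \<gamma> b * x = (if a = b then - 2 *\<^sub>R x else 0) - \<gamma> b * \<gamma> a * x"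
proof -
  have "\<gamma> a * \<gamma> b * x = ((if a = b then - 2 else 0) - \<gamma> b * \<gamma> a) * x"
    unfolding gamma_swap[of a b] ..
  then show ?thesis by (simp add: left_diff_distrib scaleR_2 mult_2)
qed

lemma gamma_commutator:
  "\<gamma> a * \<gamma> b * \<gamma> j - \<gamma> j * \<gamma> a * \<gamma> b
    = (if a = j then 2 *\<^sub>R \<gamma> b else 0) - (if b = j then 2 *\<^sub>R \<gamma> a else 0)"
  using gamma_swap_left[of "\<gamma> a" b j] gamma_swap_right[of a j "\<gamma> b"] by auto

lemma cvec_add: "cvec (\<lambda>a. u a + v a) = cvec u + cvec v"
  by (simp add: cvec_def scaleR_add_left sum.distrib)

lemma cvec_scale: "cvec (\<lambda>a. r * u a) = r *\<^sub>R cvec u"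
  by (simp add: cvec_def scaleR_right.sum)

lemma ctwo_add: "ctwo (\<lambda>a b. u a b + v a b) = ctwo u + ctwo v"
  by (simp add: ctwo_def scaleR_add_left sum.distrib scaleR_add_right)

lemma ctwo_scale: "ctwo (\<lambda>a b. r * u a b) = r *\<^sub>R ctwo u"
  by (simp add: ctwo_def scaleR_right.sum mult.commute)

text \<open>Moving \<gamma> j across a product of two generators leaves only contractions, and
  skewness makes them equal. The resulting 2 is the reason why lifted connection forms carry a
  factor 1/2.\<close>

lemma ctwo_commutator:
  assumes "\<And>a b. t a b = - t b a"
  shows "ctwo t * \<gamma> j - \<gamma> j * ctwo t = 2 *\<^sub>R cvec (t j)"
proof -
  have "ctwo t * \<gamma> j - \<gamma> j * ctwo t
      = (1/2) *\<^sub>R (\<Sum>a\<in>UNIV. \<Sum>b\<in>UNIV. t a b *\<^sub>R (\<gamma> a * \<gamma> b * \<gamma> j - \<gamma> j * \<gamma> a * \<gamma> b))"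
    by (simp add: ctwo_def sum_distrib_left sum_distrib_right scaleR_diff_right
        sum_subtractf mult.assoc)
  also have "(\<Sum>a\<in>UNIV. \<Sum>b\<in>UNIV. t a b *\<^sub>R (\<gamma> a * \<gamma> b * \<gamma> j - \<gamma> j * \<gamma> a * \<gamma> b))
     = (\<Sum>a\<in>UNIV. \<Sum>b\<in>UNIV. (if a = j then (2 * t j b) *\<^sub>R \<gamma> b else 0))
       - (\<Sum>a\<in>UNIV. \<Sum>b\<in>UNIV. (if b = j then (2 * t a j) *\<^sub>R \<gamma> a else 0))"
    unfolding gamma_commutator sum_subtractf[symmetric]
    by (intro sum.cong refl) (auto simp: algebra_simps)
  also have "(\<Sum>a\<in>UNIV. \<Sum>b\<in>UNIV. (if a = j then (2 * t j b) *\<^sub>R \<gamma> b else 0)) = 2 *\<^sub>R cvec (t j)"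
    by (subst sum.swap) (simp add: cvec_def scaleR_right.sum)
  also have "(\<Sum>a\<in>UNIV. \<Sum>b\<in>UNIV. (if b = j then (2 * t a j) *\<^sub>R \<gamma> a else 0)) = - 2 *\<^sub>R cvec (t j)"
    using assms[of _ j] by (simp add: cvec_def scaleR_right.sum sum_negf)
  finally show ?thesis by (simp add: scaleR_add_left[symmetric])
qed

text \<open>A commutator is a derivation, so the action on vectors determines the action on products
  of two generators.\<close>

lemma ctwo_commutator_ctwo:
  assumes "\<And>a b. t a b = - t b a"
  shows "ctwo t * ctwo q - ctwo q * ctwo t
    = 2 *\<^sub>R ctwo (\<lambda>b c. \<Sum>a\<in>UNIV. q a c * t a b + q b a * t a c)"
proof -
  have c: "ctwo t * (\<gamma> a * \<gamma> b) - (\<gamma> a * \<gamma> b) * ctwo t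
     = 2 *\<^sub>R (cvec (t a) * \<gamma> b + \<gamma> a * cvec (t b))" for a b
  proof -
    have "ctwo t * (\<gamma> a * \<gamma> b) - (\<gamma> a * \<gamma> b) * ctwo t
      = (ctwo t * \<gamma> a - \<gamma> a * ctwo t) * \<gamma> b + \<gamma> a * (ctwo t * \<gamma> b - \<gamma> b * ctwo t)"
      by (simp add: algebra_simps)
    then show ?thesis by (simp add: ctwo_commutator[OF assms] scaleR_add_right)
  qed
  have "ctwo t * ctwo q - ctwo q * ctwo t
     = (1/2) *\<^sub>R (\<Sum>a\<in>UNIV. \<Sum>b\<in>UNIV. q a b *\<^sub>R (ctwo t * (\<gamma> a * \<gamma> b) - (\<gamma> a * \<gamma> b) * ctwo t))"
    by (simp add: ctwo_def[of q] sum_distrib_left sum_distrib_right scaleR_diff_right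
        sum_subtractf)
  also have "\<dots> = (\<Sum>a\<in>UNIV. \<Sum>b\<in>UNIV. q a b *\<^sub>R (cvec (t a) * \<gamma> b))
      + (\<Sum>a\<in>UNIV. \<Sum>b\<in>UNIV. q a b *\<^sub>R (\<gamma> a * cvec (t b)))"
    unfolding c by (simp add: scaleR_right.sum scaleR_add_right sum.distrib)
  also have "(\<Sum>a\<in>UNIV. \<Sum>b\<in>UNIV. q a b *\<^sub>R (cvec (t a) * \<gamma> b))
     = (\<Sum>b\<in>UNIV. \<Sum>c\<in>UNIV. (\<Sum>a\<in>UNIV. q a c * t a b) *\<^sub>R (\<gamma> b * \<gamma> c))"
    unfolding scaleR_left.sum
    by (subst sum3_rotate[symmetric])
       (simp add: cvec_def sum_distrib_right scaleR_right.sum, rule sum.cong[OF refl], rule sum.swap)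
  also have "(\<Sum>a\<in>UNIV. \<Sum>b\<in>UNIV. q a b *\<^sub>R (\<gamma> a * cvec (t b)))
     = (\<Sum>b\<in>UNIV. \<Sum>c\<in>UNIV. (\<Sum>a\<in>UNIV. q b a * t a c) *\<^sub>R (\<gamma> b * \<gamma> c))"
    by (simp add: cvec_def sum_distrib_left scaleR_right.sum scaleR_left.sum)
       (rule sum.cong[OF refl], rule sum.swap)
  finally show ?thesis
    by (simp add: ctwo_def sum.distrib scaleR_add_left)
qed

lemma cthree_add: "cthree (\<lambda>k a b. q k a b + r k a b) = cthree q + cthree r"
  by (simp add: cthree_def scaleR_add_left sum.distrib)

lemma cthree_scale: "cthree (\<lambda>k a b. c * q k a b) = c *\<^sub>R cthree q"
  by (simp add: cthree_def scaleR_right.sum)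

lemma cthree_conv_ctwo: "cthree q = 2 *\<^sub>R (\<Sum>k\<in>UNIV. \<gamma> k * ctwo (q k))"
  by (simp add: cthree_def ctwo_def scaleR_right.sum sum_distrib_left mult.assoc)

text \<open>The permutation is moved from the coefficients to the generators, whose reordering costs
  contractions. The one over a, b vanishes by skewness; the other two contribute 2 and 4 times the
  trace, hence the 6.\<close>

lemma cthree_cyclic:
  assumes anti: "\<And>k a b. q k a b = - q k b a"
  shows "cthree (\<lambda>k a b. q k a b + q a b k + q b k a)
    = 3 *\<^sub>R cthree q + 6 *\<^sub>R cvec (\<lambda>b. \<Sum>k\<in>UNIV. q k k b)"
proof -
  have r1: "cthree (\<lambda>k a b. q a b k) = (\<Sum>k\<in>UNIV. \<Sum>a\<in>UNIV. \<Sum>b\<in>UNIV. q k a b *\<^sub>R (\<gamma> b * \<gamma> k * \<gamma> a))"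
    unfolding cthree_def by (rule sum3_rotate[of "\<lambda>k a b. q k a b *\<^sub>R (\<gamma> b * \<gamma> k * \<gamma> a)"])
  have r2: "cthree (\<lambda>k a b. q b k a) = (\<Sum>k\<in>UNIV. \<Sum>a\<in>UNIV. \<Sum>b\<in>UNIV. q k a b *\<^sub>R (\<gamma> a * \<gamma> b * \<gamma> k))"
    unfolding cthree_def by (rule sum3_rotate[of "\<lambda>k a b. q b k a *\<^sub>R (\<gamma> k * \<gamma> a * \<gamma> b)", symmetric])
  have m: "\<gamma> b * \<gamma> k * \<gamma> a + \<gamma> a * \<gamma> b * \<gamma> k
    = 2 *\<^sub>R (\<gamma> k * \<gamma> a * \<gamma> b) + (if a = k then 2 *\<^sub>R \<gamma> b else 0)
      - (if b = k then 4 *\<^sub>R \<gamma> a else 0) + (if a = b then 2 *\<^sub>R \<gamma> k else 0)" for k a b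
  proof -
    have "\<gamma> b * \<gamma> k * \<gamma> a + \<gamma> a * \<gamma> b * \<gamma> k
      = (\<gamma> k * \<gamma> a * \<gamma> b + \<gamma> k * \<gamma> a * \<gamma> b)
       + ((\<gamma> a * \<gamma> b * \<gamma> k - \<gamma> k * \<gamma> a * \<gamma> b)
         + (\<gamma> b * \<gamma> k * \<gamma> a + \<gamma> k * \<gamma> b * \<gamma> a)
         - (\<gamma> k * \<gamma> b * \<gamma> a + \<gamma> k * \<gamma> a * \<gamma> b))"
      by (simp only: algebra_simps)
    also have "\<gamma> b * \<gamma> k * \<gamma> a + \<gamma> k * \<gamma> b * \<gamma> a = (if b = k then - 2 *\<^sub>R \<gamma> a else 0)"
      using gamma_swap_right[of b k "\<gamma> a"] by (simp only: diff_add_cancel)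
    also have "\<gamma> k * \<gamma> b * \<gamma> a + \<gamma> k * \<gamma> a * \<gamma> b = (if b = a then - 2 *\<^sub>R \<gamma> k else 0)"
      using gamma_swap_left[of "\<gamma> k" b a] by (simp only: diff_add_cancel)
    also note gamma_commutator
    finally show ?thesis
      using scaleR_add_left[of 2 2 "\<gamma> a"] by (auto simp: scaleR_2)
  qed
  have diag: "(\<Sum>k\<in>UNIV. \<Sum>a\<in>UNIV. \<Sum>b\<in>UNIV. q k a b *\<^sub>R (if a = b then 2 *\<^sub>R \<gamma> k else 0)) = 0"
  proof -
    have "q k a a = 0" for k a using anti[of k a a] by simp
    then have "q k a b *\<^sub>R (if a = b then 2 *\<^sub>R \<gamma> k else 0) = 0" for k a b by simp
    then show ?thesis by (simp only: sum.neutral_const)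
  qed
  have d1: "(\<Sum>k\<in>UNIV. \<Sum>a\<in>UNIV. \<Sum>b\<in>UNIV. q k a b *\<^sub>R (if a = k then 2 *\<^sub>R \<gamma> b else 0))
      = 2 *\<^sub>R cvec (\<lambda>b. \<Sum>k\<in>UNIV. q k k b)"
  proof -
    have "(\<Sum>a\<in>UNIV. \<Sum>b\<in>UNIV. q k a b *\<^sub>R (if a = k then 2 *\<^sub>R \<gamma> b else 0))
        = (\<Sum>b\<in>UNIV. \<Sum>a\<in>UNIV. if a = k then (2 * q k a b) *\<^sub>R \<gamma> b else 0)" for k
      by (subst sum.swap) (intro sum.cong refl, simp)
    then have "(\<Sum>k\<in>UNIV. \<Sum>a\<in>UNIV. \<Sum>b\<in>UNIV. q k a b *\<^sub>R (if a = k then 2 *\<^sub>R \<gamma> b else 0))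
        = (\<Sum>b\<in>UNIV. \<Sum>k\<in>UNIV. (2 * q k k b) *\<^sub>R \<gamma> b)"
      by (simp only: sum.delta finite UNIV_I if_True) (rule sum.swap)
    then show ?thesis
      by (simp only: cvec_def scaleR_right.sum scaleR_left.sum scaleR_scaleR)
  qed
  have d2: "(\<Sum>k\<in>UNIV. \<Sum>a\<in>UNIV. \<Sum>b\<in>UNIV. q k a b *\<^sub>R (if b = k then 4 *\<^sub>R \<gamma> a else 0))
      = (- 4) *\<^sub>R cvec (\<lambda>b. \<Sum>k\<in>UNIV. q k k b)"
  proof -
    have "(\<Sum>a\<in>UNIV. \<Sum>b\<in>UNIV. q k a b *\<^sub>R (if b = k then 4 *\<^sub>R \<gamma> a else 0))
        = (\<Sum>a\<in>UNIV. \<Sum>b\<in>UNIV. if b = k then (- 4 * q k b a) *\<^sub>R \<gamma> a else 0)" for k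
    proof (intro sum.cong refl)
      fix a b
      show "q k a b *\<^sub>R (if b = k then 4 *\<^sub>R \<gamma> a else 0) = (if b = k then (- 4 * q k b a) *\<^sub>R \<gamma> a else 0)"
        using anti[of k a b] by simp
    qed
    then have "(\<Sum>k\<in>UNIV. \<Sum>a\<in>UNIV. \<Sum>b\<in>UNIV. q k a b *\<^sub>R (if b = k then 4 *\<^sub>R \<gamma> a else 0))
        = (\<Sum>b\<in>UNIV. \<Sum>k\<in>UNIV. (- 4 * q k k b) *\<^sub>R \<gamma> b)"
      by (simp only: sum.delta finite UNIV_I if_True) (rule sum.swap)
    then show ?thesis
      by (simp only: cvec_def scaleR_right.sum scaleR_left.sum scaleR_scaleR)
  qed
  let ?v = "cvec (\<lambda>b. \<Sum>k\<in>UNIV. q k k b)"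
  have d0: "(\<Sum>k\<in>UNIV. \<Sum>a\<in>UNIV. \<Sum>b\<in>UNIV. q k a b *\<^sub>R 2 *\<^sub>R (\<gamma> k * \<gamma> a * \<gamma> b))
      = 2 *\<^sub>R cthree q"
    unfolding cthree_def scaleR_right.sum by (intro sum.cong refl) simp
  have "cthree (\<lambda>k a b. q k a b + q a b k + q b k a)
     = cthree q + (\<Sum>k\<in>UNIV. \<Sum>a\<in>UNIV. \<Sum>b\<in>UNIV. q k a b *\<^sub>R (\<gamma> b * \<gamma> k * \<gamma> a + \<gamma> a * \<gamma> b * \<gamma> k))"
    unfolding cthree_add r1 r2 scaleR_add_right sum.distrib by (simp only: add.assoc)
  also have "(\<Sum>k\<in>UNIV. \<Sum>a\<in>UNIV. \<Sum>b\<in>UNIV. q k a b *\<^sub>R (\<gamma> b * \<gamma> k * \<gamma> a + \<gamma> a * \<gamma> b * \<gamma> k))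
     = 2 *\<^sub>R cthree q + 2 *\<^sub>R ?v - (- 4) *\<^sub>R ?v + 0"
    unfolding m scaleR_add_right scaleR_diff_right sum.distrib sum_subtractf diag d0 d1 d2 ..
  also have "cthree q + (2 *\<^sub>R cthree q + 2 *\<^sub>R ?v - (- 4) *\<^sub>R ?v + 0) = 3 *\<^sub>R cthree q + 6 *\<^sub>R ?v"
  proof -
    have "3 *\<^sub>R cthree q = (1 + 2) *\<^sub>R cthree q" "6 *\<^sub>R ?v = (2 + 4) *\<^sub>R ?v" by simp_all
    then show ?thesis by (simp only: scaleR_add_left scaleR_one scaleR_minus_left) (simp only: add_ac diff_minus_eq_add add_0_right add_0_left)
  qed
  finally show ?thesis .
qed

text \<open>Sorts the summand of \<open>killing_contraction\<close> by powers of \<kappa> and l.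
  There g, p stand for e_k and e_k _| T; x, t for X and X _| T; u, z for T(X,e_k) and T(X,e_k) _|
  T.\<close>

lemma commutator_expansion:
  fixes \<kappa> :: "'r::real_algebra_1"
  assumes central: "\<And>y. \<kappa> * y = y * \<kappa>"
  shows "g * ((\<kappa> * g - l *\<^sub>R p) * (\<kappa> * x - l *\<^sub>R t) - (\<kappa> * x - l *\<^sub>R t) * (\<kappa> * g - l *\<^sub>R p)
       + (\<kappa> * u - l *\<^sub>R z))
     = \<kappa> * \<kappa> * (g * g * x - g * x * g) - l *\<^sub>R (\<kappa> * (g * g * t - g * t * g + g * (p * x - x * p)))
       - l\<^sup>2 *\<^sub>R (g * (t * p - p * t)) + \<kappa> * (g * u) - l *\<^sub>R (g * z)"
proof -
  have c: "y * (\<kappa> * w) = \<kappa> * (y * w)" for y w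
    using central[of y] by (metis mult.assoc)
  note cs = c[of g] c[of p] c[of x] c[of t]
  show ?thesis
    by (simp add: distrib_left distrib_right left_diff_distrib right_diff_distrib cs mult.assoc
        scaleR_diff_right scaleR_add_right power2_eq_square)
qed

section \<open>Contractions over the frame index\<close>

lemma sum_gamma_sq: "(\<Sum>k\<in>UNIV. \<gamma> k * \<gamma> k * z) = (- real CARD('n)) *\<^sub>R z"
  by (simp add: gamma_sq scaleR_conv_of_real)

lemma sum_gamma_cvec: "(\<Sum>k\<in>UNIV. \<gamma> k * cvec (t k)) = 2 *\<^sub>R ctwo t"
  by (simp add: cvec_def ctwo_def sum_distrib_left)

lemma cvec_gamma: "\<gamma> k * cvec u = (- 2 * u k) *\<^sub>R 1 - cvec u * \<gamma> k"
proof -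
  have "\<gamma> k * cvec u + cvec u * \<gamma> k = (\<Sum>a\<in>UNIV. u a *\<^sub>R (\<gamma> k * \<gamma> a + \<gamma> a * \<gamma> k))"
    by (simp add: cvec_def sum_distrib_left sum_distrib_right scaleR_add_right sum.distrib)
  also have "\<dots> = (\<Sum>a\<in>UNIV. if a = k then u k *\<^sub>R (- 2) else 0)"
    by (intro sum.cong refl) (simp add: clifford_rel)
  also have "\<dots> = (- 2 * u k) *\<^sub>R 1"
    by (simp add: scaleR_conv_of_real mult.commute)
  finally show ?thesis by (simp add: algebra_simps)
qed

text \<open>The case p = 1 of the rule that the sum of e_k w e_k is (-1)^(p+1) (n - 2p) w for a
  p-form w; the case p = 2 follows.\<close>

lemma sum_gamma_cvec_gamma:
  "(\<Sum>k\<in>UNIV. \<gamma> k * cvec u * \<gamma> k) = (real CARD('n) - 2) *\<^sub>R cvec u"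
proof -
  have "\<gamma> k * cvec u * \<gamma> k = - 2 *\<^sub>R (u k *\<^sub>R \<gamma> k) + cvec u" for k
    unfolding cvec_gamma by (simp add: algebra_simps gamma_sq)
  then have "(\<Sum>k\<in>UNIV. \<gamma> k * cvec u * \<gamma> k)
      = - 2 *\<^sub>R (\<Sum>k\<in>UNIV. u k *\<^sub>R \<gamma> k) + (\<Sum>k\<in>(UNIV::'n set). cvec u)"
    by (simp only: sum.distrib scaleR_right.sum)
  then show ?thesis
    unfolding cvec_def[symmetric] sum_constant_scaleR by (simp add: scaleR_diff_left)
qed

lemma sum_gamma_ctwo_gamma:
  assumes "\<And>a b. t a b = - t b a"
  shows "(\<Sum>k\<in>UNIV. \<gamma> k * ctwo t * \<gamma> k) = (4 - real CARD('n)) *\<^sub>R ctwo t"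
proof -
  have "\<gamma> k * ctwo t * \<gamma> k = \<gamma> k * \<gamma> k * ctwo t + 2 *\<^sub>R (\<gamma> k * cvec (t k))" for k
  proof -
    have "ctwo t * \<gamma> k = \<gamma> k * ctwo t + 2 *\<^sub>R cvec (t k)"
      using ctwo_commutator[OF assms, where j=k] by (simp add: algebra_simps)
    then show ?thesis by (simp add: mult.assoc distrib_left)
  qed
  then have "(\<Sum>k\<in>UNIV. \<gamma> k * ctwo t * \<gamma> k)
      = (- real CARD('n)) *\<^sub>R ctwo t + 2 *\<^sub>R 2 *\<^sub>R ctwo t"
    by (simp only: sum.distrib sum_gamma_sq scaleR_right.sum[symmetric] sum_gamma_cvec)
  also have "\<dots> = (4 - real CARD('n)) *\<^sub>R ctwo t"
    by (simp add: scaleR_diff_left)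
  finally show ?thesis .
qed

text \<open>Splits a contraction into a 3-form part and a trace. It serves for the curvature, where
  the trace is half the Ricci tensor up to normalisation, and for both T-quadratic sums of
  \<open>killing_contraction\<close>.\<close>

lemma sum_gamma_contract:
  assumes "\<And>k a b. r k a b = - r k b a"
    and "\<And>k a b. r k a b + r a b k + r b k a = \<sigma> k a b"
  shows "(\<Sum>k\<in>UNIV. \<gamma> k * ctwo (r k))
    = (1/6) *\<^sub>R cthree \<sigma> - cvec (\<lambda>b. \<Sum>k\<in>UNIV. r k k b)"
proof -
  have "cthree \<sigma> = 3 *\<^sub>R cthree r + 6 *\<^sub>R cvec (\<lambda>b. \<Sum>k\<in>UNIV. r k k b)"
    using cthree_cyclic[of r, OF assms(1)] unfolding assms(2) .
  then show ?thesis
    by (simp add: cthree_conv_ctwo scaleR_add_right)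
qed

lemma cvec_sum: "cvec (\<lambda>a. \<Sum>c\<in>C. r c * u c a) = (\<Sum>c\<in>C. r c *\<^sub>R cvec (u c))"
proof (induction C rule: infinite_finite_induct)
  case (insert c C)
  then show ?case by (simp add: cvec_add cvec_scale)
qed (simp_all add: cvec_def)

text \<open>Here x holds the components of X, and \<open>t\<close>, \<open>\<sigma>\<close>,
  \<open>Z\<close> represent X _| T, X _| sigma_T and the sum of e_k (T(X,e_k) _| T).
  \<open>A\<close> is the Killing endomorphism, \<open>Ak k\<close> its value at e_k, and
  \<open>A (t k)\<close> its value at T(X,e_k).\<close>

lemma killing_contraction:
  fixes T :: "'n \<Rightarrow> 'n \<Rightarrow> 'n \<Rightarrow> real" and x :: "'n \<Rightarrow> real" and \<kappa> :: 'r and lam :: real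
  assumes T1: "\<And>a b c. T a b c = - T b a c" and T2: "\<And>a b c. T a b c = - T a c b"
    and central: "\<And>y. \<kappa> * y = y * \<kappa>"
  defines "t \<equiv> \<lambda>a b. \<Sum>c\<in>UNIV. x c * T c a b"
  defines "\<sigma> \<equiv> \<lambda>k a b. \<Sum>m\<in>UNIV. t k m * T m a b + t a m * T m b k + t b m * T m k a"
  defines "A \<equiv> \<lambda>u. \<kappa> * cvec u - lam *\<^sub>R ctwo (\<lambda>a b. \<Sum>c\<in>UNIV. u c * T c a b)"
  defines "Ak \<equiv> \<lambda>k. \<kappa> * \<gamma> k - lam *\<^sub>R ctwo (T k)"
  defines "Z \<equiv> \<Sum>k\<in>UNIV. \<gamma> k * ctwo (\<lambda>a b. \<Sum>m\<in>UNIV. t k m * T m a b)"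
  shows "- 2 *\<^sub>R (\<Sum>k\<in>UNIV. \<gamma> k * (Ak k * A x - A x * Ak k + A (t k)))
    = (- 16 * (lam + 1/4)) *\<^sub>R (\<kappa> * ctwo t) + (4 * (real CARD('n) - 1)) *\<^sub>R (\<kappa> * \<kappa> * cvec x)
      + lam\<^sup>2 *\<^sub>R (4 *\<^sub>R Z - 2 *\<^sub>R cthree \<sigma>) + (2 * lam) *\<^sub>R Z"
proof -
  have T3: "T a b c = T b c a" for a b c
    using T1[of a b c] T2[of b a c] by simp
  have t_anti: "t a b = - t b a" for a b
    unfolding t_def sum_negf[symmetric] by (intro sum.cong refl) (simp add: T2[of _ a b])
  \<comment> \<open>By \<open>ctwo_commutator_ctwo\<close> the commutator of X _| T with e_k _| T is
    twice \<open>ctwo (q k)\<close>.\<close>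
  define q where "q = (\<lambda>k b c. \<Sum>a\<in>UNIV. T k a c * t a b + T k b a * t a c)"
  have p4: "(\<Sum>k\<in>UNIV. \<gamma> k * (ctwo (T k) * cvec x - cvec x * ctwo (T k))) = - 4 *\<^sub>R ctwo t"
  proof -
    have "ctwo (T k) * cvec x - cvec x * ctwo (T k) = - 2 *\<^sub>R cvec (t k)" for k
    proof -
      have "ctwo (T k) * cvec x - cvec x * ctwo (T k)
        = (\<Sum>c\<in>UNIV. x c *\<^sub>R (ctwo (T k) * \<gamma> c - \<gamma> c * ctwo (T k)))"
        by (simp add: cvec_def sum_distrib_left sum_distrib_right scaleR_diff_right sum_subtractf)
      also have "\<dots> = 2 *\<^sub>R (\<Sum>c\<in>UNIV. x c *\<^sub>R cvec (T k c))"
        by (simp add: ctwo_commutator[OF T2] scaleR_right.sum mult.commute)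
      also have "(\<Sum>c\<in>UNIV. x c *\<^sub>R cvec (T k c)) = cvec (\<lambda>b. - t k b)"
        unfolding cvec_sum[symmetric] t_def sum_negf[symmetric]
        by (rule arg_cong[where f=cvec], rule ext, rule sum.cong[OF refl]) (simp add: T1[of k])
      also have "\<dots> = - cvec (t k)" using cvec_scale[of "-1" "t k"] by simp
      finally show ?thesis by simp
    qed
    then show ?thesis
      using arg_cong[OF sum_gamma_cvec[of t], of "\<lambda>z. - 2 *\<^sub>R z"]
      by (simp add: sum_negf scaleR_right.sum)
  qed
  \<comment> \<open>One relation between \<open>cthree q\<close>, \<open>cthree \<sigma>\<close> and
    the trace of q: total skewness of T and skewness of t make the cyclic sum of q equal to -2
    \<sigma>.\<close>
  have "cthree q = 2 *\<^sub>R (\<Sum>k\<in>UNIV. \<gamma> k * ctwo (q k))" by (rule cthree_conv_ctwo)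
  also have "(\<Sum>k\<in>UNIV. \<gamma> k * ctwo (q k))
      = (1/6) *\<^sub>R cthree (\<lambda>k a b. (- 2) * \<sigma> k a b) - cvec (\<lambda>b. \<Sum>k\<in>UNIV. q k k b)"
  proof (rule sum_gamma_contract)
    show "q k a b = - q k b a" for k a b
      unfolding q_def sum_negf[symmetric]
      by (intro sum.cong refl) (simp add: T2[of k _ b] T2[of k a])
    show "q k a b + q a b k + q b k a = - 2 * \<sigma> k a b" for k a b
    proof -
      have *: "T k m c * t m b + T k b m * t m c = - (T m c k * t b m + T m k b * t c m)" for k b c m
        using T3[of k m c] T3[of m k b] t_anti[of m b] t_anti[of m c] by simp
      show ?thesis unfolding q_def \<sigma>_def * sum.distrib[symmetric] sum_distrib_left
        by (intro sum.cong refl) (simp add: algebra_simps)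
    qed
  qed
  finally have cq: "cthree q = - (2/3) *\<^sub>R cthree \<sigma> - 2 *\<^sub>R cvec (\<lambda>b. \<Sum>k\<in>UNIV. q k k b)"
    by (simp only: cthree_scale) (simp add: scaleR_diff_right)
  \<comment> \<open>A second relation, with the same trace vector, which can therefore be
    eliminated.\<close>
  have "Z = (1/6) *\<^sub>R cthree \<sigma> - cvec (\<lambda>b. \<Sum>k\<in>UNIV. \<Sum>m\<in>UNIV. t k m * T m k b)"
    unfolding Z_def
  proof (rule sum_gamma_contract)
    show "(\<Sum>m\<in>UNIV. t k m * T m a b) = - (\<Sum>m\<in>UNIV. t k m * T m b a)" for k a b
      unfolding sum_negf[symmetric] by (intro sum.cong refl) (simp add: T2[of _ a b])
    show "(\<Sum>m\<in>UNIV. t k m * T m a b) + (\<Sum>m\<in>UNIV. t a m * T m b k) + (\<Sum>m\<in>UNIV. t b m * T m k a)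
      = \<sigma> k a b" for k a b
      by (simp add: \<sigma>_def sum.distrib)
  qed
  also have "(\<lambda>b. \<Sum>k\<in>UNIV. \<Sum>m\<in>UNIV. t k m * T m k b) = (\<lambda>b. \<Sum>k\<in>UNIV. q k k b)"
  proof (rule ext)
    fix b
    have "T k k a = 0" for k a using T1[of k k a] by simp
    then have "q k k b = (\<Sum>m\<in>UNIV. t m k * T k m b)" for k
      unfolding q_def by (simp add: mult.commute)
    then show "(\<Sum>k\<in>UNIV. \<Sum>m\<in>UNIV. t k m * T m k b) = (\<Sum>k\<in>UNIV. q k k b)"
      by (simp only:) (rule sum.swap)
  qed
  finally have "cvec (\<lambda>b. \<Sum>k\<in>UNIV. q k k b) = (1/6) *\<^sub>R cthree \<sigma> - Z" by simp
  then have q_Z: "cthree q = 2 *\<^sub>R Z - cthree \<sigma>"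
    using cq scaleR_diff_left[of "- (2/3)" "1/3" "cthree \<sigma>"] by (simp add: scaleR_diff_right)
  have p5: "(\<Sum>k\<in>UNIV. \<gamma> k * (ctwo t * ctwo (T k) - ctwo (T k) * ctwo t)) = 2 *\<^sub>R Z - cthree \<sigma>"
  proof -
    have "(\<Sum>k\<in>UNIV. \<gamma> k * (ctwo t * ctwo (T k) - ctwo (T k) * ctwo t)) = cthree q"
      unfolding cthree_conv_ctwo ctwo_commutator_ctwo[OF t_anti] q_def
      by (simp add: scaleR_right.sum)
    then show ?thesis unfolding q_Z .
  qed
  have summand: "\<gamma> k * (Ak k * A x - A x * Ak k + A (t k))
     = \<kappa> * \<kappa> * (\<gamma> k * \<gamma> k * cvec x - \<gamma> k * cvec x * \<gamma> k)
       - lam *\<^sub>R (\<kappa> * (\<gamma> k * \<gamma> k * ctwo t - \<gamma> k * ctwo t * \<gamma> k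
            + \<gamma> k * (ctwo (T k) * cvec x - cvec x * ctwo (T k))))
       - lam\<^sup>2 *\<^sub>R (\<gamma> k * (ctwo t * ctwo (T k) - ctwo (T k) * ctwo t))
       + \<kappa> * (\<gamma> k * cvec (t k)) - lam *\<^sub>R (\<gamma> k * ctwo (\<lambda>a b. \<Sum>m\<in>UNIV. t k m * T m a b))" for k
    unfolding A_def Ak_def t_def[symmetric] by (rule commutator_expansion[OF central])
  have "(\<Sum>k\<in>UNIV. \<gamma> k * (Ak k * A x - A x * Ak k + A (t k)))
     = \<kappa> * \<kappa> * ((- real CARD('n)) *\<^sub>R cvec x - (real CARD('n) - 2) *\<^sub>R cvec x)
       - lam *\<^sub>R (\<kappa> * ((- real CARD('n)) *\<^sub>R ctwo t - (4 - real CARD('n)) *\<^sub>R ctwo t + (- 4) *\<^sub>R ctwo t))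
       - lam\<^sup>2 *\<^sub>R (2 *\<^sub>R Z - cthree \<sigma>)
       + \<kappa> * (2 *\<^sub>R ctwo t) - lam *\<^sub>R Z"
    unfolding summand sum.distrib sum_subtractf sum_distrib_left[symmetric] scaleR_right.sum[symmetric]
      sum_gamma_sq sum_gamma_cvec_gamma sum_gamma_ctwo_gamma[OF t_anti] p4 p5 sum_gamma_cvec Z_def ..
  also have "(- real CARD('n)) *\<^sub>R cvec x - (real CARD('n) - 2) *\<^sub>R cvec x
      = (2 - 2 * real CARD('n)) *\<^sub>R cvec x"
    by (simp only: scaleR_diff_left[symmetric]) simp
  \<comment> \<open>The dimension cancels, so the coefficient of X _| T contains no explicit
    n.\<close>
  also have "(- real CARD('n)) *\<^sub>R ctwo t - (4 - real CARD('n)) *\<^sub>R ctwo t + (- 4) *\<^sub>R ctwo t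
      = (- 8) *\<^sub>R ctwo t"
    by (simp only: scaleR_diff_left[symmetric] scaleR_add_left[symmetric]) simp
  finally have sum_eq: "(\<Sum>k\<in>UNIV. \<gamma> k * (Ak k * A x - A x * Ak k + A (t k)))
     = (2 - 2 * real CARD('n)) *\<^sub>R (\<kappa> * \<kappa> * cvec x) + (8 * lam) *\<^sub>R (\<kappa> * ctwo t)
       - lam\<^sup>2 *\<^sub>R (2 *\<^sub>R Z - cthree \<sigma>) + 2 *\<^sub>R (\<kappa> * ctwo t) - lam *\<^sub>R Z"
    by (simp add: mult.commute)
  \<comment> \<open>The 8 lam stems from the commutators and the 2 from \<kappa> T(X,e_k); together
    they form 8 (lam + 1/4).\<close>
  have coeffs: "4 * (real CARD('n) - 1) = - 2 * (2 - 2 * real CARD('n))"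
    "- 16 * (lam + 1/4) = - 2 * (8 * lam) + - 2 * 2"
    by simp_all
  show ?thesis
    unfolding sum_eq coeffs scaleR_add_left
    by (simp add: scaleR_diff_right scaleR_add_right mult.commute)
qed

text \<open>The 1/2 of the lift from so(n) to spin(n) cancels the 2 of
  \<open>ctwo_commutator\<close>: commuting with a lifted connection form transforms Clifford
  elements as that form transforms their components.\<close>

lemma ctwo_parallel_commutator:
  assumes o: "\<And>a b. w a b = - w b a"
  shows "ctwo (\<lambda>a b. (1/2) * w a b) * cvec x - cvec x * ctwo (\<lambda>a b. (1/2) * w a b)
      = cvec (\<lambda>b. \<Sum>a\<in>UNIV. x a * w a b)"
    and "ctwo (\<lambda>a b. (1/2) * w a b) * ctwo q - ctwo q * ctwo (\<lambda>a b. (1/2) * w a b)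
      = ctwo (\<lambda>b c. \<Sum>a\<in>UNIV. q a c * w a b + q b a * w a c)"
proof -
  have o': "(1/2) * w a b = - ((1/2) * w b a)" for a b using o[of a b] by simp
  have "ctwo (\<lambda>a b. (1/2) * w a b) * cvec x - cvec x * ctwo (\<lambda>a b. (1/2) * w a b)
    = (\<Sum>c\<in>UNIV. x c *\<^sub>R (ctwo (\<lambda>a b. (1/2) * w a b) * \<gamma> c - \<gamma> c * ctwo (\<lambda>a b. (1/2) * w a b)))"
    by (simp only: cvec_def sum_distrib_left sum_distrib_right scaleR_diff_right sum_subtractf
        mult_scaleR_left mult_scaleR_right)
  also have "\<dots> = (\<Sum>c\<in>UNIV. x c *\<^sub>R cvec (w c))"
    by (simp only: ctwo_commutator[of "\<lambda>a b. (1/2) * w a b", OF o'] cvec_scale) simp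
  finally show "ctwo (\<lambda>a b. (1/2) * w a b) * cvec x - cvec x * ctwo (\<lambda>a b. (1/2) * w a b)
      = cvec (\<lambda>b. \<Sum>a\<in>UNIV. x a * w a b)"
    by (simp only: cvec_sum)
  have e: "(\<Sum>a\<in>UNIV. q a c * ((1/2) * w a b) + q b a * ((1/2) * w a c))
      = (1/2) * (\<Sum>a\<in>UNIV. q a c * w a b + q b a * w a c)" for b c
    unfolding sum_distrib_left by (intro sum.cong refl) (simp add: algebra_simps)
  show "ctwo (\<lambda>a b. (1/2) * w a b) * ctwo q - ctwo q * ctwo (\<lambda>a b. (1/2) * w a b)
      = ctwo (\<lambda>b c. \<Sum>a\<in>UNIV. q a c * w a b + q b a * w a c)"
    unfolding ctwo_commutator_ctwo[of "\<lambda>a b. (1/2) * w a b", OF o'] unfolding e ctwo_scale by simp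
qed

end

section \<open>Killing spinors with torsion\<close>

text \<open>Square matrices with the product \<open>**\<close> as an algebra type: on \<open>complex^'s^'s\<close> itself the
  type class product is componentwise.\<close>

typedef 's cmat = "UNIV :: (complex^'s^'s) set" morphisms mat_of cmat
  by simp

setup_lifting type_definition_cmat

instantiation cmat :: (finite) real_algebra_1
begin

lift_definition zero_cmat :: "'a cmat" is 0 .
lift_definition one_cmat :: "'a cmat" is "mat 1" .
lift_definition plus_cmat :: "'a cmat \<Rightarrow> 'a cmat \<Rightarrow> 'a cmat" is "(+)" .
lift_definition minus_cmat :: "'a cmat \<Rightarrow> 'a cmat \<Rightarrow> 'a cmat" is "(-)" .
lift_definition uminus_cmat :: "'a cmat \<Rightarrow> 'a cmat" is uminus .
lift_definition times_cmat :: "'a cmat \<Rightarrow> 'a cmat \<Rightarrow> 'a cmat" is "(**)" .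
lift_definition scaleR_cmat :: "real \<Rightarrow> 'a cmat \<Rightarrow> 'a cmat" is scaleR .

instance
proof
  fix A B C :: "'a cmat" and r q :: real
  show "A + B + C = A + (B + C)" by transfer (rule add.assoc)
  show "A + B = B + A" by transfer (rule add.commute)
  show "0 + A = A" by transfer simp
  show "- A + A = 0" by transfer simp
  show "A - B = A + - B" by transfer simp
  show "A * B * C = A * (B * C)" by transfer (simp add: matrix_mul_assoc)
  show "1 * A = A" by transfer simp
  show "A * 1 = A" by transfer simp
  show "(A + B) * C = A * C + B * C" by transfer (simp add: vec_eq_iff matrix_matrix_mult_def sum.distrib distrib_right)
  show "A * (B + C) = A * B + A * C" by transfer (rule matrix_add_ldistrib)
  show "(0::'a cmat) \<noteq> 1" by transfer (simp add: mat_def vec_eq_iff)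
  show "r *\<^sub>R (A + B) = r *\<^sub>R A + r *\<^sub>R B" by transfer (rule scaleR_add_right)
  show "(r + q) *\<^sub>R A = r *\<^sub>R A + q *\<^sub>R A" by transfer (rule scaleR_add_left)
  show "r *\<^sub>R q *\<^sub>R A = (r * q) *\<^sub>R A" by transfer simp
  show "1 *\<^sub>R A = A" by transfer simp
  show "r *\<^sub>R A * B = r *\<^sub>R (A * B)" by transfer (simp add: scalar_matrix_assoc)
  show "A * r *\<^sub>R B = r *\<^sub>R (A * B)" by transfer (simp add: matrix_scalar_ac scalar_matrix_assoc)
qed

end

lemma mat_of_sum: "mat_of (sum f A) = (\<Sum>a\<in>A. mat_of (f a))"
  by (induction A rule: infinite_finite_induct) (simp_all add: zero_cmat.rep_eq plus_cmat.rep_eq)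

lemmas mat_of_simps = mat_of_sum plus_cmat.rep_eq minus_cmat.rep_eq uminus_cmat.rep_eq
  times_cmat.rep_eq scaleR_cmat.rep_eq cmat_inverse[OF UNIV_I]

lemma mat_scalar_mult_vector:
  fixes A :: "complex^'s^'s" shows "(mat c ** A) *v x = c *s (A *v x)"
proof -
  have "mat c *v y = c *s y" for y :: "complex^'s"
    by (simp add: vec_eq_iff mat_def matrix_vector_mult_def if_distrib[of "\<lambda>z. z * _"] cong: if_cong)
  then show ?thesis by (simp flip: matrix_vector_mul_assoc)
qed

lemma mat_central:
  fixes A :: "complex^'s^'s" shows "mat c ** A = A ** mat c"
  by (simp add: vec_eq_iff mat_def matrix_matrix_mult_def if_distrib[of "\<lambda>z. z * _"]
      if_distrib[of "(*) _"] mult.commute cong: if_cong)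

lemma bounded_bilinear_matrix_vector_mult:
  "bounded_bilinear ((*v) :: complex^'s^'s \<Rightarrow> complex^'s \<Rightarrow> complex^'s)"
proof -
  have "bilinear ((*v) :: complex^'s^'s \<Rightarrow> complex^'s \<Rightarrow> complex^'s)"
    unfolding bilinear_def
    by (auto intro!: linearI simp: vec_eq_iff matrix_vector_mult_def sum.distrib
        distrib_left distrib_right scaleR_right.sum)
  then show ?thesis by (simp only: bilinear_conv_bounded_bilinear)
qed

locale killing_chart = framed_chart S G E T
  for S :: "(real^'n) set" and G :: "real^'n \<Rightarrow> (real^'n) form2"
    and E :: "'n \<Rightarrow> real^'n \<Rightarrow> real^'n" and T :: "real^'n \<Rightarrow> (real^'n) form3" +
  fixes \<gamma> :: "'n \<Rightarrow> complex^'s^'s" and \<psi> :: "real^'n \<Rightarrow> complex^'s"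
    and \<kappa> :: complex and s lam :: real
  assumes clifford: "\<gamma> a ** \<gamma> b + \<gamma> b ** \<gamma> a = mat (if a = b then - 2 else 0)"
    and spinor_smooth: "smooth_on S \<psi>"
    and killing: "x \<in> S \<Longrightarrow> spin_nabla \<gamma> G E T s x v \<psi> = \<kappa> *s (cliff_vec \<gamma> G E x v *v \<psi> x)"
    and s_eq: "s = lam + 1/4"
begin

sublocale cl: clifford_frame "\<lambda>a. cmat (\<gamma> a)"
proof
  fix a b
  have "mat_of (cmat (\<gamma> a) * cmat (\<gamma> b) + cmat (\<gamma> b) * cmat (\<gamma> a)) = mat (if a = b then - 2 else 0)"
    by (simp only: mat_of_simps clifford)
  also have "\<dots> = mat_of (if a = b then - 2 else 0)"
  proof -
    have "(2::'s cmat) = 1 + 1" by simp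
    then have "mat_of (- 2 :: 's cmat) = mat (- 2)"
      by (simp only: mat_of_simps one_cmat.rep_eq) (simp add: vec_eq_iff mat_def)
    then show ?thesis by (simp add: zero_cmat.rep_eq)
  qed
  finally show "cmat (\<gamma> a) * cmat (\<gamma> b) + cmat (\<gamma> b) * cmat (\<gamma> a) = (if a = b then - 2 else 0)"
    by (simp only: mat_of_inject)
qed

text \<open>\<open>cmat\<close> is an algebra over the reals only, so the complex Killing number
  becomes a central element.\<close>

abbreviation kap :: "'s cmat" where "kap \<equiv> cmat (mat \<kappa>)"

lemma kap_central: "kap * y = y * kap"
  by (subst mat_of_inject[symmetric]) (simp only: mat_of_simps mat_central)

lemma mat_of_cvec: "mat_of (cl.cvec u) = (\<Sum>a\<in>UNIV. u a *\<^sub>R \<gamma> a)"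
  by (simp only: cl.cvec_def mat_of_simps)

lemma mat_of_ctwo: "mat_of (cl.ctwo t) = (1/2) *\<^sub>R (\<Sum>a\<in>UNIV. \<Sum>b\<in>UNIV. t a b *\<^sub>R (\<gamma> a ** \<gamma> b))"
  by (simp only: cl.ctwo_def mat_of_simps)

lemma mat_of_cthree:
  "mat_of (cl.cthree q) = (\<Sum>k\<in>UNIV. \<Sum>a\<in>UNIV. \<Sum>b\<in>UNIV. q k a b *\<^sub>R (\<gamma> k ** \<gamma> a ** \<gamma> b))"
  by (simp only: cl.cthree_def mat_of_simps)

lemma cliff_vec_eq: "cliff_vec \<gamma> G E x v = mat_of (cl.cvec (\<lambda>a. theta a x v))"
  by (simp only: cliff_vec_def mat_of_cvec theta_def)

lemma cliff_form2_eq: "cliff_form2 \<gamma> E x \<omega> = mat_of (cl.ctwo (\<lambda>a b. \<omega> (E a x) (E b x)))"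
  by (simp add: cliff_form2_def mat_of_ctwo)

lemma cliff_form3_eq:
  "cliff_form3 \<gamma> E x \<omega> = mat_of ((1/6) *\<^sub>R cl.cthree (\<lambda>k a b. \<omega> (E k x) (E a x) (E b x)))"
  by (simp add: cliff_form3_def mat_of_cthree mat_of_simps(6) fact_numeral)

text \<open>The lift of nabla^c to spinors: together with the 1/2 inside \<open>ctwo\<close>, the
  usual 1/4 of the sum of \<open>omega a b\<close> e_a e_b.\<close>

definition spin_conn :: "real^'n \<Rightarrow> real^'n \<Rightarrow> 's cmat" where
  "spin_conn x v = cl.ctwo (\<lambda>a b. (1/2) * omega a b x v)"

definition killing_endo :: "real^'n \<Rightarrow> real^'n \<Rightarrow> 's cmat" where
  "killing_endo x v = kap * cl.cvec (\<lambda>a. theta a x v) - lam *\<^sub>R cl.ctwo (\<lambda>a b. T x v (E a x) (E b x))"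

text \<open>The value that a parallel Killing endomorphism forces on the coordinate derivative of
  \<open>killing_endo x v\<close> in direction u, for constant v.\<close>

definition killing_endo_deriv :: "real^'n \<Rightarrow> real^'n \<Rightarrow> real^'n \<Rightarrow> 's cmat" where
  "killing_endo_deriv x u v = killing_endo x (char_nabla G T x u (\<lambda>_. v)) - (spin_conn x u * killing_endo x v - killing_endo x v * spin_conn x u)"

section \<open>The Killing equation as a linear system and its integrability\<close>

lemma killing_endo_linear: "x \<in> S \<Longrightarrow> linear (killing_endo x)"
  by (rule linearI) (simp_all add: killing_endo_def linear_add[OF theta_linear] linear_cmul[OF theta_linear]
      linear_add[OF T_linear] linear_cmul[OF T_linear] cl.cvec_add cl.cvec_scale cl.ctwo_add cl.ctwo_scale
      algebra_simps)

lemma theta_const_nabla: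
  "x \<in> S \<Longrightarrow> theta a x (char_nabla G T x u (\<lambda>_. v)) = conn x u v (E a x)"
  by (simp add: theta_def char_nabla_inner linear_0[OF G_linear_left])

text \<open>The lift of the Levi-Civita connection is \<open>spin_conn\<close> minus 1/4 of v _| T,
  so adding s (v _| T) leaves the weight s - 1/4 = lam.\<close>

lemma spinor_derivative:
  assumes x: "x \<in> S"
  shows "(\<psi> has_derivative (\<lambda>v. mat_of (killing_endo x v - spin_conn x v) *v \<psi> x)) (at x)"
proof -
  have "dderiv \<psi> x v = mat_of (killing_endo x v - spin_conn x v) *v \<psi> x" for v
  proof -
    have lc: "G x (levi_civita G x v (E a)) (E b x) = omega a b x v - (1/2) * T x v (E a x) (E b x)" for a b
      by (simp only: levi_civita_inner[OF x] omega_def dE_def)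
    have c2: "cl.ctwo (\<lambda>a b. omega a b x v - (1/2) * T x v (E a x) (E b x))
      = 2 *\<^sub>R spin_conn x v - (1/2) *\<^sub>R cl.ctwo (\<lambda>a b. T x v (E a x) (E b x))"
      unfolding spin_conn_def cl.ctwo_scale
      using cl.ctwo_add[of "\<lambda>a b. omega a b x v" "\<lambda>a b. (- 1/2) * T x v (E a x) (E b x)"]
        cl.ctwo_scale[of "- 1/2" "\<lambda>a b. T x v (E a x) (E b x)"] by simp
    have "(1/4) *\<^sub>R ((\<Sum>a\<in>UNIV. \<Sum>b\<in>UNIV. G x (levi_civita G x v (E a)) (E b x) *\<^sub>R (\<gamma> a ** \<gamma> b)) *v \<psi> x)
      = mat_of ((1/2) *\<^sub>R cl.ctwo (\<lambda>a b. omega a b x v - (1/2) * T x v (E a x) (E b x))) *v \<psi> x"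
      unfolding lc mat_of_simps(6) mat_of_ctwo
      by (simp add: bounded_bilinear.scaleR_left[OF bounded_bilinear_matrix_vector_mult])
    also have "\<dots> = mat_of (spin_conn x v - (1/4) *\<^sub>R cl.ctwo (\<lambda>a b. T x v (E a x) (E b x))) *v \<psi> x"
      unfolding c2 by (simp add: scaleR_diff_right)
    finally have lhs: "spin_nabla \<gamma> G E T s x v \<psi> = dderiv \<psi> x v
       + mat_of (spin_conn x v - (1/4) *\<^sub>R cl.ctwo (\<lambda>a b. T x v (E a x) (E b x))) *v \<psi> x
       + mat_of (s *\<^sub>R cl.ctwo (\<lambda>a b. T x v (E a x) (E b x))) *v \<psi> x"
      unfolding spin_nabla_def spin_levi_civita_def cliff_form2_eq mat_of_simps(6)
      by (simp add: bounded_bilinear.scaleR_left[OF bounded_bilinear_matrix_vector_mult])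
    have rhs: "\<kappa> *s (cliff_vec \<gamma> G E x v *v \<psi> x) = mat_of (kap * cl.cvec (\<lambda>a. theta a x v)) *v \<psi> x"
      by (simp only: cliff_vec_eq mat_of_simps mat_scalar_mult_vector)
    have "dderiv \<psi> x v = mat_of (kap * cl.cvec (\<lambda>a. theta a x v)
         - (spin_conn x v - (1/4) *\<^sub>R cl.ctwo (\<lambda>a b. T x v (E a x) (E b x)))
         - s *\<^sub>R cl.ctwo (\<lambda>a b. T x v (E a x) (E b x))) *v \<psi> x"
      using killing[OF x, of v] unfolding lhs rhs
      by (simp only: mat_of_simps(3) bounded_bilinear.diff_left[OF bounded_bilinear_matrix_vector_mult])
        (simp only: algebra_simps)
    also have "kap * cl.cvec (\<lambda>a. theta a x v)
         - (spin_conn x v - (1/4) *\<^sub>R cl.ctwo (\<lambda>a b. T x v (E a x) (E b x)))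
         - s *\<^sub>R cl.ctwo (\<lambda>a b. T x v (E a x) (E b x)) = killing_endo x v - spin_conn x v"
      unfolding killing_endo_def s_eq scaleR_add_left by simp
    finally show ?thesis .
  qed
  then have "dderiv \<psi> x = (\<lambda>v. mat_of (killing_endo x v - spin_conn x v) *v \<psi> x)" by (rule ext)
  then show ?thesis
    using smooth_on_differentiable[OF spinor_smooth x] by (simp add: frechet_derivative_works)
qed

lemma mat_of_kap_cvec_derivative:
  assumes "\<And>a. ((\<lambda>y. u a y) has_derivative u' a) F"
  shows "((\<lambda>y. mat_of (kap * cl.cvec (\<lambda>a. u a y))) has_derivative (\<lambda>h. mat_of (kap * cl.cvec (\<lambda>a. u' a h)))) F"
  unfolding cl.cvec_def sum_distrib_left mult_scaleR_right mat_of_sum scaleR_cmat.rep_eq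
  by (intro has_derivative_sum has_derivative_scaleR_left assms)

lemma mat_of_ctwo_derivative:
  assumes "\<And>a b. ((\<lambda>y. t a b y) has_derivative t' a b) F"
  shows "((\<lambda>y. mat_of (cl.ctwo (\<lambda>a b. t a b y))) has_derivative (\<lambda>h. mat_of (cl.ctwo (\<lambda>a b. t' a b h)))) F"
  unfolding mat_of_ctwo
  by (intro has_derivative_sum has_derivative_scaleR_left has_derivative_scaleR_right assms)

text \<open>Metricity gives the derivative of \<open>theta\<close>, parallelism that of T. In both,
  the terms from differentiating the frame are commutators with the spin connection by
  \<open>ctwo_parallel_commutator\<close>.\<close>

lemma killing_endo_derivative:
  assumes x: "x \<in> S"
  shows "((\<lambda>y. mat_of (killing_endo y v)) has_derivative (\<lambda>u. mat_of (killing_endo_deriv x u v))) (at x)"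
proof -
  define t' where "t' a b u = T x (char_nabla G T x u (\<lambda>_. v)) (E a x) (E b x)
     + T x v (char_nabla G T x u (E a)) (E b x) + T x v (E a x) (char_nabla G T x u (E b))" for a b u
  have "((\<lambda>y. mat_of (killing_endo y v)) has_derivative
      (\<lambda>u. mat_of (kap * cl.cvec (\<lambda>a. dtheta a x u v)) - lam *\<^sub>R mat_of (cl.ctwo (\<lambda>a b. t' a b u)))) (at x)"
    unfolding killing_endo_def minus_cmat.rep_eq scaleR_cmat.rep_eq t'_def
    by (intro has_derivative_diff has_derivative_scaleR_right mat_of_kap_cvec_derivative
        mat_of_ctwo_derivative theta_derivative[OF x]
        T_fields_derivative[OF smooth_on_const E_smooth E_smooth x])
  moreover have "mat_of (kap * cl.cvec (\<lambda>a. dtheta a x u v)) - lam *\<^sub>R mat_of (cl.ctwo (\<lambda>a b. t' a b u))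
      = mat_of (killing_endo_deriv x u v)" for u
  proof -
    let ?w = "\<lambda>a b. omega a b x u"
    have sk: "?w a b = - ?w b a" for a b by (rule omega_skew[OF x])
    have "cl.cvec (\<lambda>a. dtheta a x u v) = cl.cvec (\<lambda>a. theta a x (char_nabla G T x u (\<lambda>_. v)))
        - cl.cvec (\<lambda>b. \<Sum>a\<in>UNIV. theta a x v * omega a b x u)"
    proof -
      have "dtheta b x u v = theta b x (char_nabla G T x u (\<lambda>_. v))
          + - 1 * (\<Sum>a\<in>UNIV. theta a x v * omega a b x u)" for b
        unfolding dtheta_eq[OF x] theta_const_nabla[OF x]
        by (simp add: sk[of b] sum_negf mult.commute)
      then show ?thesis by (simp only: cl.cvec_add cl.cvec_scale) simp
    qed
    then have c1: "cl.cvec (\<lambda>a. dtheta a x u v) = cl.cvec (\<lambda>a. theta a x (char_nabla G T x u (\<lambda>_. v)))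
        - (spin_conn x u * cl.cvec (\<lambda>a. theta a x v) - cl.cvec (\<lambda>a. theta a x v) * spin_conn x u)"
      unfolding spin_conn_def cl.ctwo_parallel_commutator(1)[of ?w, OF sk] .
    have "cl.ctwo (\<lambda>a b. t' a b u) = cl.ctwo (\<lambda>a b. T x (char_nabla G T x u (\<lambda>_. v)) (E a x) (E b x))
        - cl.ctwo (\<lambda>b c. \<Sum>a\<in>UNIV. T x v (E a x) (E c x) * omega a b x u + T x v (E b x) (E a x) * omega a c x u)"
    proof -
      have "t' b c u = T x (char_nabla G T x u (\<lambda>_. v)) (E b x) (E c x)
          + - 1 * (\<Sum>a\<in>UNIV. T x v (E a x) (E c x) * omega a b x u + T x v (E b x) (E a x) * omega a c x u)" for b c
        unfolding t'_def char_nabla_frame[OF x] linear_sum[OF T_linear2[OF x]] linear_cmul[OF T_linear2[OF x]]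
          linear_sum[OF T_linear3[OF x]] linear_cmul[OF T_linear3[OF x]]
        by (simp add: sk[of b] sk[of c] sum_negf sum.distrib mult.commute)
      then show ?thesis by (simp only: cl.ctwo_add cl.ctwo_scale) simp
    qed
    then have c2: "cl.ctwo (\<lambda>a b. t' a b u) = cl.ctwo (\<lambda>a b. T x (char_nabla G T x u (\<lambda>_. v)) (E a x) (E b x))
        - (spin_conn x u * cl.ctwo (\<lambda>a b. T x v (E a x) (E b x)) - cl.ctwo (\<lambda>a b. T x v (E a x) (E b x)) * spin_conn x u)"
      unfolding spin_conn_def cl.ctwo_parallel_commutator(2)[of ?w, OF sk] .
    have k: "y * (kap * z) = kap * (y * z)" for y z
      using kap_central[of y] by (metis mult.assoc)
    have "kap * cl.cvec (\<lambda>a. dtheta a x u v) - lam *\<^sub>R cl.ctwo (\<lambda>a b. t' a b u) = killing_endo_deriv x u v"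
      unfolding c1 c2 killing_endo_deriv_def killing_endo_def
      by (simp add: right_diff_distrib left_diff_distrib scaleR_diff_right k mult.assoc)
    then show ?thesis by (simp only: mat_of_simps(3,6)[symmetric])
  qed
  ultimately show ?thesis by simp
qed

text \<open>Differentiates \<open>spinor_derivative\<close> once more and exchanges the constant
  directions u and v.\<close>

lemma spinor_integrability:
  assumes x: "x \<in> S"
  shows "mat_of (cl.ctwo (\<lambda>a b. (1/2) * curv a b x u v)) *v \<psi> x
    = mat_of (killing_endo x v * killing_endo x u - killing_endo x u * killing_endo x v + killing_endo x (torsion_vec G T x u v)) *v \<psi> x"
proof -
  interpret mv: bounded_bilinear "(*v) :: complex^'s^'s \<Rightarrow> complex^'s \<Rightarrow> complex^'s"
    by (rule bounded_bilinear_matrix_vector_mult)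
  let ?B = "\<lambda>v. killing_endo x v - spin_conn x v"
  define dB where "dB u v = killing_endo_deriv x u v - cl.ctwo (\<lambda>a b. (1/2) * domega a b x u v)" for u v
  have B: "((\<lambda>y. mat_of (killing_endo y v - spin_conn y v)) has_derivative (\<lambda>u. mat_of (dB u v))) (at x)" for v
    unfolding minus_cmat.rep_eq spin_conn_def dB_def
    by (intro has_derivative_diff killing_endo_derivative[OF x] mat_of_ctwo_derivative has_derivative_mult_right
        omega_derivative[OF x])
  have D: "((\<lambda>y. mat_of (killing_endo y v - spin_conn y v) *v \<psi> y) has_derivative
      (\<lambda>u. mat_of (?B v) *v (mat_of (?B u) *v \<psi> x) + mat_of (dB u v) *v \<psi> x)) (at x)" for v
    by (rule mv.FDERIV[OF B spinor_derivative[OF x]])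
  from second_derivative_symmetric[OF open_S x, of \<psi> "\<lambda>y v. mat_of (killing_endo y v - spin_conn y v) *v \<psi> y", OF spinor_derivative D D, of v u]
  have sym: "mat_of (?B v) *v (mat_of (?B u) *v \<psi> x) + mat_of (dB u v) *v \<psi> x
      = mat_of (?B u) *v (mat_of (?B v) *v \<psi> x) + mat_of (dB v u) *v \<psi> x"
    by simp
  have expand: "mat_of (P * Q + R - (P' * Q' + R')) *v y
      = mat_of P *v (mat_of Q *v y) + mat_of R *v y - (mat_of P' *v (mat_of Q' *v y) + mat_of R' *v y)"
    for P Q R P' Q' R' :: "'s cmat" and y
    by (simp only: mat_of_simps mv.add_left mv.diff_left matrix_vector_mul_assoc)
  have zero: "mat_of (?B v * ?B u + dB u v - (?B u * ?B v + dB v u)) *v \<psi> x = 0"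
    unfolding expand sym by simp
  have sk: "omega a b x v = - omega b a x v" for a b by (rule omega_skew[OF x])
  \<comment> \<open>The second structure equation in the Clifford algebra: the commutator supplies
    the part of \<open>curv\<close> quadratic in \<open>omega\<close>.\<close>
  have OO: "spin_conn x v * spin_conn x u - spin_conn x u * spin_conn x v
      = cl.ctwo (\<lambda>a b. (1/2) * domega a b x u v) - cl.ctwo (\<lambda>a b. (1/2) * domega a b x v u)
        - cl.ctwo (\<lambda>a b. (1/2) * curv a b x u v)"
  proof -
    have "spin_conn x v * spin_conn x u - spin_conn x u * spin_conn x v = cl.ctwo (\<lambda>b c. \<Sum>a\<in>UNIV.
        (1/2) * omega a c x u * omega a b x v + (1/2) * omega b a x u * omega a c x v)"
      unfolding spin_conn_def by (rule cl.ctwo_parallel_commutator(2)) (rule sk)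
    also have "(\<lambda>b c. \<Sum>a\<in>UNIV. (1/2) * omega a c x u * omega a b x v + (1/2) * omega b a x u * omega a c x v)
      = (\<lambda>b c. ((1/2) * domega b c x u v + - 1 * ((1/2) * domega b c x v u)) + - 1 * ((1/2) * curv b c x u v))"
    proof (intro ext)
      fix b c
      have "(\<Sum>a\<in>UNIV. (1/2) * omega a c x u * omega a b x v + (1/2) * omega b a x u * omega a c x v)
        = - (1/2) * (\<Sum>a\<in>UNIV. omega b a x v * omega a c x u - omega b a x u * omega a c x v)"
        unfolding sum_distrib_left by (intro sum.cong refl) (simp add: sk[of b] algebra_simps)
      then show "(\<Sum>a\<in>UNIV. (1/2) * omega a c x u * omega a b x v + (1/2) * omega b a x u * omega a c x v)
        = ((1/2) * domega b c x u v + - 1 * ((1/2) * domega b c x v u)) + - 1 * ((1/2) * curv b c x u v)"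
        by (simp add: curv_def add_divide_distrib diff_divide_distrib)
    qed
    finally show ?thesis by (simp only: cl.ctwo_add cl.ctwo_scale) simp
  qed
  have tors: "killing_endo x (char_nabla G T x u (\<lambda>_. v)) - killing_endo x (char_nabla G T x v (\<lambda>_. u)) = killing_endo x (torsion_vec G T x u v)"
    unfolding const_nabla_torsion[OF x, symmetric] linear_diff[OF killing_endo_linear[OF x]] ..
  \<comment> \<open>The mixed products of \<open>spin_conn\<close> and \<open>killing_endo\<close>
    cancel against the commutators contained in \<open>killing_endo_deriv\<close>.\<close>
  have "?B v * ?B u + dB u v - (?B u * ?B v + dB v u)
     = (killing_endo x v * killing_endo x u - killing_endo x u * killing_endo x v + (killing_endo x (char_nabla G T x u (\<lambda>_. v)) - killing_endo x (char_nabla G T x v (\<lambda>_. u))))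
      + ((spin_conn x v * spin_conn x u - spin_conn x u * spin_conn x v) - (cl.ctwo (\<lambda>a b. (1/2) * domega a b x u v) - cl.ctwo (\<lambda>a b. (1/2) * domega a b x v u)))"
    unfolding dB_def killing_endo_deriv_def by (simp add: algebra_simps)
  also have "\<dots> = (killing_endo x v * killing_endo x u - killing_endo x u * killing_endo x v + killing_endo x (torsion_vec G T x u v))
      - cl.ctwo (\<lambda>a b. (1/2) * curv a b x u v)"
    unfolding OO tors by simp
  finally show ?thesis using zero
    by (simp only: mat_of_simps(3) mv.diff_left) simp
qed

section \<open>The Ricci identity in one chart\<close>

lemma mat_of_kap: "mat_of (r *\<^sub>R (kap * A)) *v y = (of_real r * \<kappa>) *s (mat_of A *v y)"
proof -
  have "mat_of (r *\<^sub>R (kap * A)) *v y = r *\<^sub>R (\<kappa> *s (mat_of A *v y))"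
    by (simp only: mat_of_simps mat_scalar_mult_vector
        bounded_bilinear.scaleR_left[OF bounded_bilinear_matrix_vector_mult])
  also have "\<dots> = (of_real r * \<kappa>) *s (mat_of A *v y)"
    by (simp add: vec_eq_iff scaleR_conv_of_real[where 'a=complex])
  finally show ?thesis .
qed

lemma killing_ricci:
  assumes x: "x \<in> S" and X: "X differentiable (at x)"
  shows "cliff_vec \<gamma> G E x (char_Ric_endo G T E X x) *v \<psi> x =
      (- 16 * of_real s * \<kappa>) *s (cliff_form2 \<gamma> E x (T x (X x)) *v \<psi> x)
      + (4 * of_real (real CARD('n) - 1) * \<kappa>\<^sup>2) *s (cliff_vec \<gamma> G E x (X x) *v \<psi> x)
      + (1 - 12 * lam\<^sup>2) *\<^sub>R (cliff_form3 \<gamma> E x (sigma_form E T x (X x)) *v \<psi> x)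
      + (2 * (2 * lam\<^sup>2 + lam)) *\<^sub>R (\<Sum>k\<in>UNIV.
          (cliff_vec \<gamma> G E x (E k x)
           ** cliff_form2 \<gamma> E x (T x (torsion_vec G T x (X x) (E k x)))) *v \<psi> x)"
proof -
  interpret mv: bounded_bilinear "(*v) :: complex^'s^'s \<Rightarrow> complex^'s \<Rightarrow> complex^'s"
    by (rule bounded_bilinear_matrix_vector_mult)
  define Tc where "Tc a b c = T x (E a x) (E b x) (E c x)" for a b c
  \<comment> \<open>With this r, \<open>ctwo (r k)\<close> is the action of R(X,e_k) on
    spinors.\<close>
  define r where "r k a b = (1/2) * curv a b x (X x) (E k x)" for k a b
  define t where "t a b = T x (X x) (E a x) (E b x)" for a b
  define xv where "xv a = theta a x (X x)" for a
  define \<sigma> where "\<sigma> = sigma_comp x (X x)"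
  define N where "N k = killing_endo x (E k x) * killing_endo x (X x) - killing_endo x (X x) * killing_endo x (E k x)
      + killing_endo x (torsion_vec G T x (X x) (E k x))" for k
  define Z where "Z = (\<Sum>k\<in>UNIV. cmat (\<gamma> k) * cl.ctwo (\<lambda>a b. \<Sum>m\<in>UNIV. t k m * Tc m a b))"
  have t_eq: "t = (\<lambda>a b. \<Sum>c\<in>UNIV. xv c * Tc c a b)"
    unfolding t_def xv_def Tc_def by (intro ext linear_frame[OF x T_linear[OF x]])
  have Ric: "(\<lambda>b. theta b x (char_Ric_endo G T E X x)) = (\<lambda>b. 2 * (\<Sum>k\<in>UNIV. r k k b))"
    unfolding theta_char_Ric_endo[OF x X] r_def sum_distrib_left
  proof (intro ext sum.cong refl)
    fix b m
    show "curv b m x (E m x) (X x) = 2 * (1 / 2 * curv m b x (X x) (E m x))"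
      using curv_skew[OF x, of b m "E m x" "X x"] curv_skew_args[of m b x "E m x" "X x"] by simp
  qed
  have r_skew: "r k a b = - r k b a" for k a b
    unfolding r_def using curv_skew[OF x, of a b "X x" "E k x"] by simp
  have r_cyc: "r k a b + r a b k + r b k a = (1/2) * \<sigma> k a b" for k a b
    using curv_cyclic[OF x, of a b "X x" k] by (simp add: r_def \<sigma>_def)
  have contract: "(\<Sum>k\<in>UNIV. cmat (\<gamma> k) * cl.ctwo (r k))
      = (1/6) *\<^sub>R (1/2) *\<^sub>R cl.cthree \<sigma> - cl.cvec (\<lambda>b. \<Sum>k\<in>UNIV. r k k b)"
    using cl.sum_gamma_contract[OF r_skew r_cyc] by (simp only: cl.cthree_scale)
  have ric_eq: "cl.cvec (\<lambda>b. theta b x (char_Ric_endo G T E X x))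
      = (1/6) *\<^sub>R cl.cthree \<sigma> + - 2 *\<^sub>R (\<Sum>k\<in>UNIV. cmat (\<gamma> k) * cl.ctwo (r k))"
    unfolding Ric contract cl.cvec_scale by (simp add: scaleR_diff_right)
  have killing_endo_frame: "killing_endo x (E k x) = kap * cmat (\<gamma> k) - lam *\<^sub>R cl.ctwo (Tc k)" for k
  proof -
    have "cl.cvec (\<lambda>a. theta a x (E k x)) = cmat (\<gamma> k)"
      by (simp add: cl.cvec_def theta_frame[OF x] if_distrib[of "\<lambda>c. c *\<^sub>R _"] cong: if_cong)
    then show ?thesis by (simp only: killing_endo_def Tc_def[abs_def])
  qed
  have killing_endo_comp: "killing_endo x w = kap * cl.cvec (\<lambda>a. theta a x w)
      - lam *\<^sub>R cl.ctwo (\<lambda>a b. \<Sum>c\<in>UNIV. theta c x w * Tc c a b)" for w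
    unfolding killing_endo_def Tc_def using linear_frame[OF x T_linear[OF x], of w] by simp
  have theta_tors: "(\<lambda>m. theta m x (torsion_vec G T x (X x) (E k x))) = t k" for k
    by (simp add: theta_def torsion_vec_inner[OF x] t_def fun_eq_iff)
  have \<sigma>_eq: "\<sigma> = (\<lambda>k a b. \<Sum>m\<in>UNIV. t k m * Tc m a b + t a m * Tc m b k + t b m * Tc m k a)"
    by (simp add: \<sigma>_def sigma_comp_def t_def Tc_def fun_eq_iff)
  have NN: "- 2 *\<^sub>R (\<Sum>k\<in>UNIV. cmat (\<gamma> k) * N k)
    = (- 16 * (lam + 1/4)) *\<^sub>R (kap * cl.ctwo t) + (4 * (real CARD('n) - 1)) *\<^sub>R (kap * kap * cl.cvec xv)
      + lam\<^sup>2 *\<^sub>R (4 *\<^sub>R Z - 2 *\<^sub>R cl.cthree \<sigma>) + (2 * lam) *\<^sub>R Z"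
  proof -
    have N_eq: "N k = (kap * cmat (\<gamma> k) - lam *\<^sub>R cl.ctwo (Tc k))
          * (kap * cl.cvec xv - lam *\<^sub>R cl.ctwo (\<lambda>a b. \<Sum>c\<in>UNIV. xv c * Tc c a b))
        - (kap * cl.cvec xv - lam *\<^sub>R cl.ctwo (\<lambda>a b. \<Sum>c\<in>UNIV. xv c * Tc c a b))
          * (kap * cmat (\<gamma> k) - lam *\<^sub>R cl.ctwo (Tc k))
        + (kap * cl.cvec (t k) - lam *\<^sub>R cl.ctwo (\<lambda>a b. \<Sum>c\<in>UNIV. t k c * Tc c a b))" for k
      unfolding N_def killing_endo_frame killing_endo_comp[of "X x"] killing_endo_comp[of "torsion_vec G T x (X x) (E k x)"] theta_tors
        fun_cong[OF theta_tors] xv_def[symmetric] xv_def[abs_def, symmetric] ..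
    have T1: "Tc a b c = - Tc b a c" and T2: "Tc a b c = - Tc a c b" for a b c
      unfolding Tc_def by (rule T_skew12[OF x], rule T_skew23[OF x])
    show ?thesis
      unfolding N_eq Z_def \<sigma>_eq unfolding t_eq
      by (rule cl.killing_contraction[OF T1 T2 kap_central])
  qed
  \<comment> \<open>The integrability condition holds on \<psi> only, but multiplication from the
    left by \<gamma> k preserves it.\<close>
  have "mat_of (\<Sum>k\<in>UNIV. cmat (\<gamma> k) * cl.ctwo (r k)) *v \<psi> x = mat_of (\<Sum>k\<in>UNIV. cmat (\<gamma> k) * N k) *v \<psi> x"
  proof -
    have "mat_of (cl.ctwo (r k)) *v \<psi> x = mat_of (N k) *v \<psi> x" for k
      unfolding r_def N_def by (rule spinor_integrability[OF x])
    then show ?thesis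
      by (simp add: mat_of_sum times_cmat.rep_eq mv.sum_left flip: matrix_vector_mul_assoc)
  qed
  then have "cliff_vec \<gamma> G E x (char_Ric_endo G T E X x) *v \<psi> x
      = mat_of ((1/6) *\<^sub>R cl.cthree \<sigma> + - 2 *\<^sub>R (\<Sum>k\<in>UNIV. cmat (\<gamma> k) * N k)) *v \<psi> x"
    unfolding cliff_vec_eq ric_eq by (simp only: mat_of_simps(2,6) mv.add_left mv.scaleR_left)
  \<comment> \<open>As X _| sigma_T is 1/6 of \<open>cthree \<sigma>\<close>, the coefficient -2
    lam^2 of the latter becomes -12 lam^2; Z collects 4 lam^2 + 2 lam.\<close>
  also have "(1/6) *\<^sub>R cl.cthree \<sigma> + - 2 *\<^sub>R (\<Sum>k\<in>UNIV. cmat (\<gamma> k) * N k)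
     = (- 16 * s) *\<^sub>R (kap * cl.ctwo t) + (4 * (real CARD('n) - 1)) *\<^sub>R (kap * (kap * cl.cvec xv))
      + (1 - 12 * lam\<^sup>2) *\<^sub>R ((1/6) *\<^sub>R cl.cthree \<sigma>) + (2 * (2 * lam\<^sup>2 + lam)) *\<^sub>R Z"
    unfolding NN s_eq by (simp add: mult.assoc scaleR_diff_left scaleR_diff_right scaleR_add_left diff_divide_distrib mult.commute)
  also have "mat_of \<dots> *v \<psi> x = (of_real (- 16 * s) * \<kappa>) *s (mat_of (cl.ctwo t) *v \<psi> x)
      + (of_real (4 * (real CARD('n) - 1)) * \<kappa>) *s (\<kappa> *s (mat_of (cl.cvec xv) *v \<psi> x))
      + (1 - 12 * lam\<^sup>2) *\<^sub>R (mat_of ((1/6) *\<^sub>R cl.cthree \<sigma>) *v \<psi> x)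
      + (2 * (2 * lam\<^sup>2 + lam)) *\<^sub>R (mat_of Z *v \<psi> x)"
    unfolding mat_of_simps(2) mv.add_left mat_of_kap mat_of_kap[of 1, simplified]
    by (simp only: mat_of_simps(6) mv.scaleR_left)
  also have "mat_of Z *v \<psi> x = (\<Sum>k\<in>UNIV.
          (cliff_vec \<gamma> G E x (E k x)
           ** cliff_form2 \<gamma> E x (T x (torsion_vec G T x (X x) (E k x)))) *v \<psi> x)"
  proof -
    have "cl.cvec (\<lambda>a. theta a x (E k x)) = cmat (\<gamma> k)" for k
      by (simp add: cl.cvec_def theta_frame[OF x] if_distrib[of "\<lambda>c. c *\<^sub>R _"] cong: if_cong)
    then show ?thesis
      unfolding cliff_vec_eq cliff_form2_eq T_torsion_vec[OF x]
      by (simp add: Z_def mat_of_sum times_cmat.rep_eq mv.sum_left t_def Tc_def)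
  qed
  also have "mat_of (cl.ctwo t) = cliff_form2 \<gamma> E x (T x (X x))"
    unfolding cliff_form2_eq t_def ..
  also have "mat_of (cl.cvec xv) = cliff_vec \<gamma> G E x (X x)"
    unfolding cliff_vec_eq xv_def ..
  also have "mat_of ((1/6) *\<^sub>R cl.cthree \<sigma>) = cliff_form3 \<gamma> E x (sigma_form E T x (X x))"
    unfolding cliff_form3_eq sigma_form_eq[OF x] \<sigma>_def ..
  finally show ?thesis
    by (simp add: vector_smult_assoc power2_eq_square mult.assoc)
qed

end

theorem theoremA2:
  fixes U :: "'i \<Rightarrow> 'm::{t2_space, second_countable_topology} set"
    and \<phi> :: "'i \<Rightarrow> 'm \<Rightarrow> real^'n"
    and g :: "'i \<Rightarrow> real^'n \<Rightarrow> (real^'n) form2"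
    and e :: "'i \<Rightarrow> 'n \<Rightarrow> real^'n \<Rightarrow> real^'n"
    and \<gamma> :: "'n \<Rightarrow> complex^'s^'s"
    and h :: "'i \<Rightarrow> 'i \<Rightarrow> 'm \<Rightarrow> complex^'s^'s"
    and T :: "'i \<Rightarrow> real^'n \<Rightarrow> (real^'n) form3"
    and \<psi> :: "'i \<Rightarrow> real^'n \<Rightarrow> complex^'s"
    and \<kappa> :: complex
    and n s lam :: real
  assumes "spin_manifold U \<phi> g e \<gamma> h"
    and "CARD('n) \<ge> 4"
    and "n = real CARD('n)"
    and "three_form U \<phi> T"
    and "char_parallel U \<phi> g T"
    and "s = (n - 1) / (4 * (n - 3))"
    and "lam = 1 / (2 * (n - 3))"
    and "killing_spinor_torsion U \<phi> g e \<gamma> h T s \<kappa> \<psi>"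
  shows "\<forall>X. vector_field U \<phi> X \<longrightarrow> (\<forall>i. \<forall>x \<in> \<phi> i ` U i.
    cliff_vec \<gamma> (g i) (e i) x (char_Ric_endo (g i) (T i) (e i) (X i) x) *v \<psi> i x =
      (- 16 * of_real s * \<kappa>) *s (cliff_form2 \<gamma> (e i) x (T i x (X i x)) *v \<psi> i x)
      + (4 * of_real (n - 1) * \<kappa>\<^sup>2) *s (cliff_vec \<gamma> (g i) (e i) x (X i x) *v \<psi> i x)
      + (1 - 12 * lam\<^sup>2) *\<^sub>R
          (cliff_form3 \<gamma> (e i) x (sigma_form (e i) (T i) x (X i x)) *v \<psi> i x)
      + (2 * (2 * lam\<^sup>2 + lam)) *\<^sub>R (\<Sum>k\<in>UNIV.
          (cliff_vec \<gamma> (g i) (e i) x (e i k x)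
           ** cliff_form2 \<gamma> (e i) x (T i x (torsion_vec (g i) (T i) x (X i x) (e i k x)))) *v \<psi> i x))"
proof (intro allI impI ballI)
  fix X i x
  assume X: "vector_field U \<phi> X" and x: "x \<in> \<phi> i ` U i"
  interpret spin_manifold U \<phi> g e \<gamma> h by fact
  note T = \<open>three_form U \<phi> T\<close>[unfolded three_form_def]
  note killing_eq = \<open>killing_spinor_torsion U \<phi> g e \<gamma> h T s \<kappa> \<psi>\<close>[unfolded killing_spinor_torsion_def spinor_field_def]
  have n: "n \<ge> 4" using assms(2,3) by simp
  \<comment> \<open>Write n - 1 = 2 + (n - 3) in the numerator.\<close>
  have s_eq: "s = lam + 1/4"
    unfolding assms(6,7) using n by (simp add: field_simps)
  \<comment> \<open>The identity is pointwise, so it can be checked in the given chart with its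
    frame.\<close>
  interpret killing_chart "\<phi> i ` U i" "g i" "e i" "T i" \<gamma> "\<psi> i" \<kappa> s lam
  proof (intro killing_chart.intro framed_chart.intro killing_chart_axioms.intro)
    show "open (\<phi> i ` U i)" by (rule open_img)
    show "char_nabla_T (g i) (T i) x v Y Z W = 0"
      if "smooth_on (\<phi> i ` U i) Y" "smooth_on (\<phi> i ` U i) Z" "smooth_on (\<phi> i ` U i) W" "x \<in> \<phi> i ` U i"
      for Y Z W x v
      using \<open>char_parallel U \<phi> g T\<close> that unfolding char_parallel_def by blast
    show "spin_nabla \<gamma> (g i) (e i) (T i) s x v (\<psi> i) = \<kappa> *s (cliff_vec \<gamma> (g i) (e i) x v *v \<psi> i x)"
      if "x \<in> \<phi> i ` U i" for x v
      using killing_eq that by blast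
    show "linear (\<lambda>u. T i x u v w)" if "x \<in> \<phi> i ` U i" for x v w using T that by blast
    show "T i x u v w = - T i x v u w" if "x \<in> \<phi> i ` U i" for x u v w using T that by blast
    show "T i x u v w = - T i x u w v" if "x \<in> \<phi> i ` U i" for x u v w using T that by blast
    show "smooth_on (\<phi> i ` U i) (\<lambda>x. T i x u v w)" for u v w using T by blast
    show "smooth_on (\<phi> i ` U i) (\<psi> i)" using killing_eq by blast
  qed (rule metric_bilinear metric_sym metric_smooth frame_smooth frame_orthonormal clifford s_eq; assumption?)+
  have "X i differentiable (at x)"
    using X x unfolding vector_field_def by (intro smooth_on_differentiable[of "\<phi> i ` U i"]) auto
  from killing_ricci[OF x this]
  show "cliff_vec \<gamma> (g i) (e i) x (char_Ric_endo (g i) (T i) (e i) (X i) x) *v \<psi> i x =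
      (- 16 * of_real s * \<kappa>) *s (cliff_form2 \<gamma> (e i) x (T i x (X i x)) *v \<psi> i x)
      + (4 * of_real (n - 1) * \<kappa>\<^sup>2) *s (cliff_vec \<gamma> (g i) (e i) x (X i x) *v \<psi> i x)
      + (1 - 12 * lam\<^sup>2) *\<^sub>R
          (cliff_form3 \<gamma> (e i) x (sigma_form (e i) (T i) x (X i x)) *v \<psi> i x)
      + (2 * (2 * lam\<^sup>2 + lam)) *\<^sub>R (\<Sum>k\<in>UNIV.
          (cliff_vec \<gamma> (g i) (e i) x (e i k x)
           ** cliff_form2 \<gamma> (e i) x (T i x (torsion_vec (g i) (T i) x (X i x) (e i k x)))) *v \<psi> i x)"
    unfolding \<open>n = real CARD('n)\<close> .
qed

end
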